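(* Let $\mathbb{B}$ be a quasi-Banach space and $\mathcal{B}=\{e_j\}_{j=1}^\infty$ an unconditional basis of $\mathbb{B}$ (normalized, with unconditionality constant $1$, as in the context). Assume that $h_\ell(N)=h_\ell(N;\mathcal{B},\mathbb{B})$ is doubling. Then for all $\alpha>0$ and $0<q\le\infty$ we have the continuous embeddings $$\ell^{q}_{k^\alpha h_r(k)}(\mathcal{B},\mathbb{B})\hookrightarrow \mathcal{A}^\alpha_q(\mathcal{B},\mathbb{B})\hookrightarrow \ell^{q}_{k^\alpha h_\ell(k)}(\mathcal{B},\mathbb{B}).$$ Moreover, for fixed $\alpha$ and $q$ these inclusions are best possible in the scale of weighted discrete Lorentz spaces, in the following sense. (i) (Lower embedding.) If $\omega\in\mathbb{W}_+$ and $\ell^q_\omega(\mathcal{B},\mathbb{B})\hookrightarrow\mathcal{A}^\alpha_q(\mathcal{B},\mathbb{B})$, then $\omega(k)\gtrsim k^\alpha$. If in addition $\omega(k)=k^\alpha\eta(k)$ with $\eta$ increasing and doubling, then $\eta(k)\gtrsim h_r(k)$ when $i_\eta>0$, and $\eta(k)\gtrsim h_r(k)/(\log (k+1))^{1/\rho}$ when $i_\eta=0$, where $\rho=\rho_{\mathbb{B}}$. If $(\mathbb{B},\mathcal{B})$ satisfies Property (H), then for every $\omega\in\mathbb{W}_+$ with $\ell^q_\omega(\mathcal{B},\mathbb{B})\hookrightarrow\mathcal{A}^\alpha_q(\mathcal{B},\mathbb{B})$ one has $\omega(k)\gtrsim k^\alpha h_r(k)$. (ii) (Upper embedding.) If $\omega\in\mathbb{W}$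 and $\mathcal{A}^\alpha_q(\mathcal{B},\mathbb{B})\hookrightarrow\ell^q_\omega(\mathcal{B},\mathbb{B})$, then $\omega(k)\lesssim k^\alpha h_\ell(k)$.
   Context: Basis. $(\mathbb{B},\|\cdot\|_{\mathbb{B}})$ is a quasi-Banach space whose quasi-norm satisfies $\|x+y\|_{\mathbb{B}}^{\rho}\le\|x\|_{\mathbb{B}}^{\rho}+\|y\|_{\mathbb{B}}^{\rho}$ for some fixed $\rho=\rho_{\mathbb{B}}\in(0,1]$. A sequence $\mathcal{B}=\{e_j\}_{j=1}^\infty$ is a basis if each $x\in\mathbb{B}$ is uniquely $x=\sum_j c_je_j$ with convergence in $\|\cdot\|_{\mathbb{B}}$; it is unconditional (with constant $K$) if $\|\sum_j\lambda_jc_je_j\|_{\mathbb{B}}\le K\|\sum_jc_je_j\|_{\mathbb{B}}$ whenever $|\lambda_j|\le1$. Standing assumptions: $\|e_j\|_{\mathbb{B}}=1$ for all $j$ and $K=1$. For finite $\Gamma\subset\mathbb{N}$ write $1_\Gamma=\sum_{k\in\Gamma}e_k$. Democracy functions. $h_r(N)=\sup_{|\Gamma|=N}\|1_\Gamma\|_{\mathbb{B}}$ and $h_\ell(N)=\inf_{|\Gamma|=N}\|1_\Gamma\|_{\mathbb{B}}$, $N=1,2,\dots$. Approximation spaces. $\Sigma_N$ is the set of $y\in\mathbb{B}$ with at most $N$ nonzero coefficients in the basis; $\sigma_N(x)=\inf_{y\in\Sigma_N}\|x-y\|_{\mathbb{B}}$. $\mathcal{A}^\alpha_q(\mathcal{B},\mathbb{B})$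 is the set of $x\in\mathbb{B}$ with $\|x\|_{\mathcal{A}^\alpha_q}=\|x\|_{\mathbb{B}}+\big[\sum_{N\ge1}(N^\alpha\sigma_N(x))^q\frac1N\big]^{1/q}<\infty$ (with $\sup_{N\ge1}N^\alpha\sigma_N(x)$ in place of the bracket if $q=\infty$). Weights. A positive sequence $\eta$ is doubling if $\eta(2k)\le C\eta(k)$ for all $k\ge1$ and some $C>0$; "increasing" means $\eta(k)\le\eta(k+1)$. $\mathbb{W}$ is the set of positive, increasing, doubling sequences with $\lim_k\eta(k)=\infty$. For increasing $\eta$ let $M_\eta(m)=\sup_{k\in\mathbb{N}}\eta(k)/\eta(mk)$; $\mathbb{W}_+$ is the set of $\eta\in\mathbb{W}$ with $M_\eta(\kappa)<1$ for some integer $\kappa>1$. The lower dilation index is $i_\eta=\sup_{m\ge2}\frac{\log M_\eta(m)}{-\log m}$. Lorentz spaces. For a scalar sequence $s$ tending to $0$ let $s^*$ be the decreasing rearrangement of $\{|s_k|\}$ and $\|s\|_{\ell^q_\eta}=\big[\sum_{k\ge1}(\eta(k)s_k^* )^q\frac1k\big]^{1/q}$ ($\sup_k\eta(k)s_k^*$ if $q=\infty$). $\ell^q_\eta(\mathcal{B},\mathbb{B})=\{x=\sum_jc_je_j\in\mathbb{B}:\|\{c_j\}\|_{\ell^q_\eta}<\infty\}$ with quasi-norm $\|x\|_{\ell^q_\eta(\mathcal{B},\mathbb{B})}=\|\{c_j\}\|_{\ell^q_\eta}$. Property (H): for each $n=1,2,\dots$ there is $\Gamma_n\subset\mathbb{N}$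 with $|\Gamma_n|=2^n$ such that $\|1_{\Gamma'}\|_{\mathbb{B}}\approx h_r(2^{n-1})$ for all $\Gamma'\subset\Gamma_n$ with $|\Gamma'|=2^{n-1}$, with constants independent of $n$ and $\Gamma'$. $X\hookrightarrow Y$ means $X\subset Y$ and $\|x\|_Y\le C\|x\|_X$ for all $x\in X$. $a(k)\lesssim b(k)$ means $a(k)\le Cb(k)$ for all $k\ge 1$ with $C$ independent of $k$; $\gtrsim$ is the reverse and $\approx$ means both. *)

theory Defs
  imports "HOL-Analysis.Analysis"
begin

text \<open>Conventions. The vectors of the basis are indexed by all of \<^typ>\<open>nat\<close>, starting at 0
  (a pure relabelling). Every other sequence (weights, democracy functions, rearrangements,
  approximation errors) is indexed by \<open>k \<ge> 1\<close>; its value at 0 is never used.\<close>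

section \<open>Quasi-Banach spaces and bases\<close>

text \<open>By the Gelfand-Mazur theorem a \<^class>\<open>real_normed_field\<close> is, isometrically, the real or the
  complex numbers, so the class covers exactly the two usual choices of scalars.\<close>

locale quasi_banach = vector_space sc
  for sc :: "'k::real_normed_field \<Rightarrow> 'a::ab_group_add \<Rightarrow> 'a"
    and qn :: "'a \<Rightarrow> real" and \<rho> :: real +
  assumes qn_nonneg: "0 \<le> qn x"
    and qn_eq_0_iff: "qn x = 0 \<longleftrightarrow> x = 0"
    and qn_scale: "qn (sc c x) = norm c * qn x"
    and rho_pos: "0 < \<rho>" and rho_le_1: "\<rho> \<le> 1"
    and qn_triangle: "qn (x + y) powr \<rho> \<le> qn x powr \<rho> + qn y powr \<rho>"
    and qn_complete:
      "(\<forall>\<epsilon>>0. \<exists>M. \<forall>m\<ge>M. \<forall>n\<ge>M. qn (X m - X n) < \<epsilon>)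
        \<Longrightarrow> \<exists>x. (\<lambda>n. qn (X n - x)) \<longlonglongrightarrow> 0"

definition expands ::
    "('k \<Rightarrow> 'a \<Rightarrow> 'a) \<Rightarrow> ('a \<Rightarrow> real) \<Rightarrow> (nat \<Rightarrow> 'a) \<Rightarrow> (nat \<Rightarrow> 'k) \<Rightarrow> 'a::ab_group_add \<Rightarrow> bool" where
  "expands sc qn e c x \<longleftrightarrow> (\<lambda>n. qn (x - (\<Sum>j<n. sc (c j) (e j)))) \<longlonglongrightarrow> 0"

definition basis ::
    "('k \<Rightarrow> 'a \<Rightarrow> 'a) \<Rightarrow> ('a \<Rightarrow> real) \<Rightarrow> (nat \<Rightarrow> 'a::ab_group_add) \<Rightarrow> bool" where
  "basis sc qn e \<longleftrightarrow> (\<forall>x. \<exists>!c. expands sc qn e c x)"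

definition coeffs ::
    "('k \<Rightarrow> 'a \<Rightarrow> 'a) \<Rightarrow> ('a \<Rightarrow> real) \<Rightarrow> (nat \<Rightarrow> 'a::ab_group_add) \<Rightarrow> 'a \<Rightarrow> nat \<Rightarrow> 'k" where
  "coeffs sc qn e x = (THE c. expands sc qn e c x)"

definition unconditional_basis ::
    "('k::real_normed_field \<Rightarrow> 'a \<Rightarrow> 'a) \<Rightarrow> ('a \<Rightarrow> real) \<Rightarrow> (nat \<Rightarrow> 'a::ab_group_add) \<Rightarrow> real \<Rightarrow> bool" where
  "unconditional_basis sc qn e K \<longleftrightarrow> basis sc qn e \<and>
     (\<forall>c x \<mu>. expands sc qn e c x \<and> (\<forall>j. norm (\<mu> j) \<le> 1) \<longrightarrow>
        (\<exists>y. expands sc qn e (\<lambda>j. \<mu> j * c j) y \<and> qn y \<le> K * qn x))"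

section \<open>Democracy functions\<close>

definition h_right :: "('a::ab_group_add \<Rightarrow> real) \<Rightarrow> (nat \<Rightarrow> 'a) \<Rightarrow> nat \<Rightarrow> real" where
  "h_right qn e N = (SUP \<Gamma>\<in>{\<Gamma>. finite \<Gamma> \<and> card \<Gamma> = N}. qn (\<Sum>k\<in>\<Gamma>. e k))"

definition h_left :: "('a::ab_group_add \<Rightarrow> real) \<Rightarrow> (nat \<Rightarrow> 'a) \<Rightarrow> nat \<Rightarrow> real" where
  "h_left qn e N = (INF \<Gamma>\<in>{\<Gamma>. finite \<Gamma> \<and> card \<Gamma> = N}. qn (\<Sum>k\<in>\<Gamma>. e k))"

definition property_H :: "('a::ab_group_add \<Rightarrow> real) \<Rightarrow> (nat \<Rightarrow> 'a) \<Rightarrow> bool" where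
  "property_H qn e \<longleftrightarrow> (\<exists>c>0. \<exists>C>0. \<forall>n\<ge>1. \<exists>\<Gamma>. finite \<Gamma> \<and> card \<Gamma> = 2 ^ n \<and>
     (\<forall>\<Gamma>'\<subseteq>\<Gamma>. card \<Gamma>' = 2 ^ (n - 1) \<longrightarrow>
        c * h_right qn e (2 ^ (n - 1)) \<le> qn (\<Sum>k\<in>\<Gamma>'. e k) \<and>
        qn (\<Sum>k\<in>\<Gamma>'. e k) \<le> C * h_right qn e (2 ^ (n - 1))))"

section \<open>Approximation and Lorentz spaces\<close>

text \<open>The functional \<open>[\<Sum>k\<ge>1. (a k)^q / k]^(1/q)\<close>, respectively \<open>sup k\<ge>1. a k\<close> for \<open>q = \<infinity>\<close>,
  of a nonnegative sequence.\<close>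

definition lq_bracket :: "ennreal \<Rightarrow> (nat \<Rightarrow> real) \<Rightarrow> ennreal" where
  "lq_bracket q a =
     (if q = \<infinity> then (SUP k\<in>{1..}. ennreal (a k))
      else let S = (\<Sum>n. ennreal (a (Suc n) powr enn2real q / real (Suc n)))
           in if S = \<infinity> then \<infinity> else ennreal (enn2real S powr (1 / enn2real q)))"

definition Sigma_N ::
    "('k::zero \<Rightarrow> 'a \<Rightarrow> 'a) \<Rightarrow> ('a \<Rightarrow> real) \<Rightarrow> (nat \<Rightarrow> 'a::ab_group_add) \<Rightarrow> nat \<Rightarrow> 'a set" where
  "Sigma_N sc qn e N =
     {y. finite {j. coeffs sc qn e y j \<noteq> 0} \<and> card {j. coeffs sc qn e y j \<noteq> 0} \<le> N}"

definition approx_error ::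
    "('k::zero \<Rightarrow> 'a \<Rightarrow> 'a) \<Rightarrow> ('a \<Rightarrow> real) \<Rightarrow> (nat \<Rightarrow> 'a::ab_group_add) \<Rightarrow> nat \<Rightarrow> 'a \<Rightarrow> real" where
  "approx_error sc qn e N x = (INF y\<in>Sigma_N sc qn e N. qn (x - y))"

definition approx_norm ::
    "('k::zero \<Rightarrow> 'a \<Rightarrow> 'a) \<Rightarrow> ('a \<Rightarrow> real) \<Rightarrow> (nat \<Rightarrow> 'a::ab_group_add) \<Rightarrow> real \<Rightarrow> ennreal
      \<Rightarrow> 'a \<Rightarrow> ennreal" where
  "approx_norm sc qn e \<alpha> q x =
     ennreal (qn x) + lq_bracket q (\<lambda>N. real N powr \<alpha> * approx_error sc qn e N x)"

text \<open>\<open>decr_rearr s k\<close>, for \<open>k \<ge> 1\<close>, is the \<open>k\<close>-th largest of the values \<open>norm (s j)\<close>, counted with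
  multiplicity, for a null sequence \<open>s\<close>. The sequences used below are basis coefficients of a
  vector, which tend to 0 because the basis is normalized.\<close>

definition decr_rearr :: "(nat \<Rightarrow> 'k::real_normed_field) \<Rightarrow> nat \<Rightarrow> real" where
  "decr_rearr s k =
     Inf {t. 0 \<le> t \<and> finite {j. t < norm (s j)} \<and> card {j. t < norm (s j)} < k}"

definition lorentz_norm ::
    "('k::real_normed_field \<Rightarrow> 'a \<Rightarrow> 'a) \<Rightarrow> ('a \<Rightarrow> real) \<Rightarrow> (nat \<Rightarrow> 'a::ab_group_add) \<Rightarrow> ennreal
      \<Rightarrow> (nat \<Rightarrow> real) \<Rightarrow> 'a \<Rightarrow> ennreal" where
  "lorentz_norm sc qn e q \<eta> x = lq_bracket q (\<lambda>k. \<eta> k * decr_rearr (coeffs sc qn e x) k)"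

text \<open>A space is represented by its extended quasi-norm and consists of the vectors at which that
  is finite.\<close>

definition space_of :: "('a \<Rightarrow> ennreal) \<Rightarrow> 'a set" where
  "space_of nX = {x. nX x < \<infinity>}"

definition embeds :: "('a \<Rightarrow> ennreal) \<Rightarrow> ('a \<Rightarrow> ennreal) \<Rightarrow> bool" where
  "embeds nX nY \<longleftrightarrow> space_of nX \<subseteq> space_of nY \<and>
     (\<exists>C>0. \<forall>x\<in>space_of nX. nY x \<le> ennreal C * nX x)"

section \<open>Weights\<close>

definition lesssim :: "(nat \<Rightarrow> real) \<Rightarrow> (nat \<Rightarrow> real) \<Rightarrow> bool" where
  "lesssim a b \<longleftrightarrow> (\<exists>C>0. \<forall>k\<ge>1. a k \<le> C * b k)"

definition doubling :: "(nat \<Rightarrow> real) \<Rightarrow> bool" where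
  "doubling \<eta> \<longleftrightarrow> (\<exists>C>0. \<forall>k\<ge>1. \<eta> (2 * k) \<le> C * \<eta> k)"

definition incr_weight :: "(nat \<Rightarrow> real) \<Rightarrow> bool" where
  "incr_weight \<eta> \<longleftrightarrow> (\<forall>k\<ge>1. \<eta> k \<le> \<eta> (k + 1))"

definition weights :: "(nat \<Rightarrow> real) set" where
  "weights = {\<eta>. (\<forall>k\<ge>1. 0 < \<eta> k) \<and> incr_weight \<eta> \<and> doubling \<eta> \<and> filterlim \<eta> at_top sequentially}"

text \<open>For an increasing positive sequence the quotients lie in \<open>(0, 1]\<close>, so the supremum exists.\<close>

definition dil :: "(nat \<Rightarrow> real) \<Rightarrow> nat \<Rightarrow> real" where
  "dil \<eta> m = (SUP k\<in>{1..}. \<eta> k / \<eta> (m * k))"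

definition weights_plus :: "(nat \<Rightarrow> real) set" where
  "weights_plus = {\<eta> \<in> weights. \<exists>\<kappa>>1. dil \<eta> \<kappa> < 1}"

definition lower_index :: "(nat \<Rightarrow> real) \<Rightarrow> ereal" where
  "lower_index \<eta> = (SUP m\<in>{2..}. ereal (ln (dil \<eta> m) / (- ln (real m))))"

end

theory Submission
  imports Defs
begin

text \<open>Write \<open>c\<^sup>*\<close> for the decreasing rearrangement of the coefficients of a vector \<open>x\<close>, and \<open>\<sigma>\<^sub>N\<close> for its
approximation errors. All weights in play change by at most a constant factor between \<open>k\<close> and \<open>2k\<close>,
while \<open>c\<^sup>*\<close> and \<open>\<sigma>\<close> decrease. Hence each bracket is equivalent to the plain \<open>\<ell>\<^sup>q\<close> norm of its sequence
sampled at powers of two, and everything reduces to comparing such dyadic samples.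

\<^emph>\<open>Embeddings.\<close> Cut the coefficients of \<open>x\<close> at the levels \<open>c\<^sup>*(2\<^sup>j)\<close>. The coefficients between two consecutive
levels number less than \<open>2\<^sup>j\<^sup>+\<^sup>1\<close> and are at most \<open>c\<^sup>*(2\<^sup>j)\<close>, so by unconditionality they contribute at most
\<open>c\<^sup>*(2\<^sup>j) h\<^sub>r(2\<^sup>j\<^sup>+\<^sup>1)\<close>. Adding the contributions with \<open>j \<ge> m\<close> by the \<open>\<rho>\<close>-triangle inequality bounds
\<open>\<sigma>\<close> at \<open>2\<^sup>m\<close> (\<open>greedy_remainder_powr_le\<close>), and a Hardy inequality (\<open>lq_le_geometric_average\<close>), which is
available because of the factor \<open>k\<^sup>\<alpha>\<close>, gives the first embedding. For the second one, an approximant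
with \<open>N\<close> terms misses at least \<open>N\<close> of the \<open>2N\<close> largest coefficients of \<open>x\<close>; hence
\<open>c\<^sup>*(2N) h\<^sub>\<ell>(N) \<le> \<sigma>\<^sub>N\<close> (\<open>decr_rearr_times_hl_le_err\<close>), and doubling of \<open>h\<^sub>\<ell>\<close> turns this into a comparison at \<open>2N\<close>.

\<^emph>\<open>Optimality below.\<close> Test the embedding on the sums \<open>1\<^sub>\<Gamma>\<close>. If \<open>\<omega> \<in> W\<^sub>+\<close>, the values \<open>\<omega>(2\<^sup>j)\<close> grow at least
geometrically, so the Lorentz norm of \<open>1\<^sub>\<Gamma>\<close> with \<open>|\<Gamma>| \<le> 2\<^sup>J\<^sup>+\<^sup>1\<close> is \<open>\<lesssim> \<omega>(2\<^sup>J)\<close>, and the embedding yields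
\<open>2\<^sup>J\<^sup>\<alpha> \<sigma>(1\<^sub>\<Gamma>) \<lesssim> \<omega>(2\<^sup>J)\<close> for the error with \<open>2\<^sup>J\<close> terms (\<open>err_ind_le_weight\<close>). Since \<open>\<sigma>\<^sub>N(1\<^sub>\<Gamma>)\<close> is bounded below by the
least \<open>\<parallel>1\<^bsub>\<Gamma>'\<^esub>\<parallel>\<close> over the \<open>\<Gamma>' \<subseteq> \<Gamma>\<close> that omit at most \<open>N\<close> points, this gives \<open>\<omega> \<gtrsim> k\<^sup>\<alpha>\<close> at once, and
\<open>\<omega> \<gtrsim> k\<^sup>\<alpha> h\<^sub>r\<close> for the sets of Property (H). For \<open>\<omega> = k\<^sup>\<alpha> \<eta>\<close> the same bound says that \<open>2\<^sup>J\<close> of the points of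
\<open>\<Gamma>\<close> can be removed so that the rest has norm \<open>\<lesssim> \<eta>(2\<^sup>J)\<close>. Repeating this with the removed points bounds
\<open>\<parallel>1\<^sub>\<Gamma>\<parallel>\<^sup>\<rho>\<close> by a multiple of the sum of the \<open>\<eta>(2\<^sup>j)\<^sup>\<rho>\<close> with \<open>j \<le> J\<close> (\<open>hr_powr_le_sum\<close>). The sum is geometric if \<open>i\<^sub>\<eta> > 0\<close>, and has
about \<open>log\<close> many terms, each at most the last one, in any case.

\<^emph>\<open>Optimality above.\<close> Test the embedding on \<open>1\<^sub>\<Gamma>\<close> with \<open>|\<Gamma>| = 2\<^sup>J\<close> and \<open>\<parallel>1\<^sub>\<Gamma>\<parallel> \<le> 2 h\<^sub>\<ell>(2\<^sup>J)\<close>: its errors vanish from \<open>2\<^sup>J\<close> on,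
so its approximation norm is \<open>\<lesssim> 2\<^sup>J\<^sup>\<alpha> h\<^sub>\<ell>(2\<^sup>J)\<close>, while its Lorentz norm is \<open>\<gtrsim> \<omega>(2\<^sup>J)\<close>.\<close>

section \<open>The weighted sequence norm on dyadic indices\<close>

text \<open>The unweighted \<open>\<ell>\<^sup>q\<close> norm of \<open>u\<close> is at most \<open>R\<close>, in terms of real partial sums. As a bound instead of a
value it avoids infinite norms and treats \<open>q = \<infinity>\<close> together with finite \<open>q\<close>. It is applied to sequences sampled at
powers of two, on which the weight \<open>1/k\<close> of the bracket disappears, since a dyadic block has \<open>1/k\<close>-mass comparable to 1.\<close>

definition lq_le :: "ennreal \<Rightarrow> (nat \<Rightarrow> real) \<Rightarrow> real \<Rightarrow> bool" where
  "lq_le q u R \<longleftrightarrow>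
     (if q = \<infinity> then \<forall>j. u j \<le> R
      else \<forall>n. (\<Sum>j<n. u j powr enn2real q) \<le> R powr enn2real q)"

lemma enn2real_pos: "0 < q \<Longrightarrow> q \<noteq> \<infinity> \<Longrightarrow> 0 < enn2real q"
  by (simp add: enn2real_positive_iff less_top)

lemma suminf_ennreal_le_iff:
  assumes "\<And>n. 0 \<le> g n" "0 \<le> B"
  shows "(\<Sum>n. ennreal (g n)) \<le> ennreal B \<longleftrightarrow> (\<forall>n. (\<Sum>i<n. g i) \<le> B)"
proof
  assume L: "(\<Sum>n. ennreal (g n)) \<le> ennreal B"
  show "\<forall>n. (\<Sum>i<n. g i) \<le> B"
  proof
    fix n
    have "ennreal (\<Sum>i<n. g i) = (\<Sum>i<n. ennreal (g i))"
      using assms by simp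
    also have "\<dots> \<le> (\<Sum>n. ennreal (g n))"
      by (rule sum_le_suminf) auto
    finally show "(\<Sum>i<n. g i) \<le> B"
      using L assms by (metis order_trans ennreal_le_iff)
  qed
next
  assume "\<forall>n. (\<Sum>i<n. g i) \<le> B"
  then show "(\<Sum>n. ennreal (g n)) \<le> ennreal B"
    by (intro suminf_le_const) (use assms in \<open>auto simp: sum_ennreal ennreal_leI\<close>)
qed

lemma lq_bracket_le_iff:
  assumes q: "0 < q" and R: "0 \<le> R" and a: "\<And>k. 1 \<le> k \<Longrightarrow> 0 \<le> a k"
  shows "lq_bracket q a \<le> ennreal R \<longleftrightarrow>
     (if q = \<infinity> then \<forall>k\<ge>1. a k \<le> R
      else \<forall>n. (\<Sum>k=1..n. a k powr enn2real q / real k) \<le> R powr enn2real q)"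
proof (cases "q = \<infinity>")
  case True
  then show ?thesis
    using R by (auto simp: lq_bracket_def SUP_le_iff ennreal_le_iff)
next
  case False
  define p where "p = enn2real q"
  have p: "0 < p" unfolding p_def using enn2real_pos[OF q False] .
  define g where "g n = a (Suc n) powr p / real (Suc n)" for n
  define S where "S = (\<Sum>n. ennreal (g n))"
  have "lq_bracket q a = (if S = \<infinity> then \<infinity> else ennreal (enn2real S powr (1 / p)))"
    using False by (simp add: lq_bracket_def S_def g_def p_def Let_def)
  also have "\<dots> \<le> ennreal R \<longleftrightarrow> S \<le> ennreal (R powr p)"
  proof (cases "S = \<infinity>")
    case True
    then show ?thesis by (auto simp: top_unique)
  next
    case False
    then obtain s where s: "0 \<le> s" "S = ennreal s" by (cases S) auto
    have "s powr (1/p) \<le> R \<longleftrightarrow> s \<le> R powr p"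
    proof
      assume "s powr (1/p) \<le> R"
      then have "(s powr (1/p)) powr p \<le> R powr p" using p by (intro powr_mono2) auto
      then show "s \<le> R powr p" using p s by (simp add: powr_powr)
    next
      assume "s \<le> R powr p"
      then have "s powr (1/p) \<le> (R powr p) powr (1/p)" using p s by (intro powr_mono2) auto
      then show "s powr (1/p) \<le> R" using p R by (simp add: powr_powr)
    qed
    then show ?thesis using s R by (simp add: ennreal_le_iff)
  qed
  also have "\<dots> \<longleftrightarrow> (\<forall>n. (\<Sum>i<n. g i) \<le> R powr p)"
    unfolding S_def by (rule suminf_ennreal_le_iff) (auto simp: g_def)
  also have "(\<lambda>n. \<Sum>i<n. g i) = (\<lambda>n. \<Sum>k=1..n. a k powr p / real k)"
    unfolding g_def using sum.shift_bounds_cl_Suc_ivl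
    by (auto simp: fun_eq_iff sum.atLeast1_atMost_eq lessThan_atLeast0)
  then have "(\<forall>n. (\<Sum>i<n. g i) \<le> R powr p) \<longleftrightarrow> (\<forall>n. (\<Sum>k=1..n. a k powr p / real k) \<le> R powr p)"
    by metis
  finally show ?thesis using False by (simp add: p_def)
qed

lemma lq_le_cong_le:
  assumes "0 < q" "\<And>j. 0 \<le> v j" "\<And>j. v j \<le> u j" "lq_le q u R"
  shows "lq_le q v R"
proof (cases "q = \<infinity>")
  case True
  with assms show ?thesis unfolding lq_le_def by (auto intro: order_trans)
next
  case False
  have "(\<Sum>j<n. v j powr enn2real q) \<le> (\<Sum>j<n. u j powr enn2real q)" for n
    using enn2real_pos[OF assms(1) False] assms
    by (intro sum_mono powr_mono2) auto
  with assms False show ?thesis unfolding lq_le_def by (metis order_trans)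
qed

lemma lq_le_mono_bound:
  assumes "0 < q" "lq_le q u R" "0 \<le> R" "R \<le> S"
  shows "lq_le q u S"
proof (cases "q = \<infinity>")
  case True
  with assms show ?thesis unfolding lq_le_def by (auto intro: order_trans)
next
  case False
  have "R powr enn2real q \<le> S powr enn2real q"
    using enn2real_pos[OF assms(1) False] assms by (intro powr_mono2) auto
  with assms False show ?thesis unfolding lq_le_def by (metis order_trans)
qed

lemma lq_le_scale:
  assumes "0 < q" "0 \<le> C" "0 \<le> R" "\<And>j. 0 \<le> u j" "lq_le q u R"
  shows "lq_le q (\<lambda>j. C * u j) (C * R)"
proof (cases "q = \<infinity>")
  case True
  with assms show ?thesis unfolding lq_le_def by (auto intro: mult_left_mono)
next
  case False
  then show ?thesis using assms unfolding lq_le_def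
    by (auto simp: powr_mult sum_distrib_left[symmetric] intro!: mult_left_mono)
qed

lemma lq_le_pointwise:
  assumes "0 < q" "0 \<le> R" "\<And>j. 0 \<le> u j" "lq_le q u R"
  shows "u j \<le> R"
proof (cases "q = \<infinity>")
  case True
  with assms show ?thesis unfolding lq_le_def by auto
next
  case False
  define p where "p = enn2real q"
  have p: "0 < p" unfolding p_def using enn2real_pos[OF assms(1) False] .
  have "u j powr p \<le> (\<Sum>j<Suc j. u j powr p)"
    by (rule member_le_sum) auto
  also have "\<dots> \<le> R powr p"
    using assms False unfolding lq_le_def p_def by presburger
  finally show ?thesis using p assms by (meson powr_le_cancel_iff powr_less_mono2 not_le)
qed

text \<open>The common feature of doubling weights, decreasing sequences and their products that makes a value at a power of two
represent the whole dyadic block after it.\<close>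

definition slowly_growing :: "real \<Rightarrow> (nat \<Rightarrow> real) \<Rightarrow> bool" where
  "slowly_growing D a \<longleftrightarrow> (\<forall>k\<ge>1. 0 \<le> a k \<and> (\<forall>l. k \<le> l \<and> l \<le> 2 * k \<longrightarrow> a l \<le> D * a k))"

text \<open>On the block \<open>2\<^sup>j \<le> k < 2\<^sup>j\<^sup>+\<^sup>1\<close> the sequence is at most \<open>D\<close> times its first value, and the \<open>2\<^sup>j\<close> weights \<open>1/k\<close>
are at most \<open>1/2\<^sup>j\<close>.\<close>

lemma lq_bracket_le_if_dyadic:
  assumes q: "0 < q" and R: "0 \<le> R" and D: "0 \<le> D" and a: "slowly_growing D a"
    and le: "lq_le q (\<lambda>j. a (2 ^ j)) R"
  shows "lq_bracket q a \<le> ennreal (D * R)"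
proof -
  have nn: "\<And>k. 1 \<le> k \<Longrightarrow> 0 \<le> a k" using a by (auto simp: slowly_growing_def)
  have blk: "a k \<le> D * a (2^j)" if "2^j \<le> k" "k < 2^Suc j" for j k :: nat
    using a that unfolding slowly_growing_def by auto
  show ?thesis
  proof (cases "q = \<infinity>")
    case True
    have "a k \<le> D * R" if k: "1 \<le> k" for k
    proof -
      obtain j where j: "2^j \<le> k" "k < 2^Suc j"
        using ex_power_ivl1[of 2 k] k by auto
      have "a k \<le> D * a (2^j)" by (rule blk[OF j])
      also have "\<dots> \<le> D * R" using le True D unfolding lq_le_def by (auto intro: mult_left_mono)
      finally show ?thesis .
    qed
    then show ?thesis using True q R D nn by (subst lq_bracket_le_iff) auto
  next
    case False
    define p where "p = enn2real q"
    have p: "0 < p" unfolding p_def using enn2real_pos[OF q False] .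
    have ind: "(\<Sum>k=1..<2^n. a k powr p / real k) \<le> D powr p * (\<Sum>j<n. a (2^j) powr p)" for n
    proof (induction n)
      case 0
      then show ?case by simp
    next
      case (Suc n)
      have "(\<Sum>k=1..<2^Suc n. a k powr p / real k)
          = (\<Sum>k=1..<2^n. a k powr p / real k) + (\<Sum>k=2^n..<2^Suc n. a k powr p / real k)"
        by (rule sum.atLeastLessThan_concat[symmetric]) auto
      also have "(\<Sum>k=2^n..<2^Suc n. a k powr p / real k)
          \<le> (\<Sum>k=(2::nat)^n..<2^Suc n. (D * a (2^n)) powr p / 2^n)"
      proof (rule sum_mono)
        fix k :: nat assume k: "k \<in> {2^n..<2^Suc n}"
        then have "1 \<le> k" by (metis atLeastLessThan_iff one_le_power one_le_numeral order_trans)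
        moreover have "(2::real)^n \<le> real k" using k by (metis atLeastLessThan_iff numeral_power_le_of_nat_cancel_iff)
        ultimately show "a k powr p / real k \<le> (D * a (2^n)) powr p / 2^n"
          using k p nn[of k] blk[of n k] by (intro frac_le powr_mono2) auto
      qed
      also have "\<dots> = (D * a (2^n)) powr p" by simp
      also have "\<dots> = D powr p * a (2^n) powr p" using D nn[of "2^n"] by (simp add: powr_mult)
      finally show ?case using Suc.IH by (simp add: algebra_simps)
    qed
    have "(\<Sum>k=1..n. a k powr p / real k) \<le> (D * R) powr p" for n
    proof -
      have "(\<Sum>k=1..n. a k powr p / real k) \<le> (\<Sum>k=1..<2^n. a k powr p / real k)"
        by (rule sum_mono2) (auto intro: le_less_trans[OF _ less_exp])
      also have "\<dots> \<le> D powr p * (\<Sum>j<n. a (2^j) powr p)" by (rule ind)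
      also have "\<dots> \<le> D powr p * R powr p"
        using le False by (intro mult_left_mono) (auto simp: lq_le_def p_def)
      finally show ?thesis using D R by (simp add: powr_mult)
    qed
    then show ?thesis using False q R D nn by (subst lq_bracket_le_iff) (auto simp: p_def)
  qed
qed

text \<open>Converse comparison: the value at \<open>2\<^sup>j\<close> is at most \<open>D\<close> times each value on the block \<open>2\<^sup>j\<^sup>-\<^sup>1 < k \<le> 2\<^sup>j\<close> before it, whose
weights \<open>1/k\<close> have sum at least \<open>1/2\<close>.\<close>

lemma dyadic_le_if_lq_bracket:
  assumes q: "0 < q" and D: "1 \<le> D"
  obtains C where "0 < C"
    "\<And>a R. slowly_growing D a \<Longrightarrow> 0 \<le> R \<Longrightarrow> lq_bracket q a \<le> ennreal R \<Longrightarrow> lq_le q (\<lambda>j. a (2 ^ j)) (C * R)"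
proof (cases "q = \<infinity>")
  case True
  show thesis
  proof (rule that[of 1])
    fix a R
    assume a: "slowly_growing D a" "0 \<le> R" "lq_bracket q a \<le> ennreal R"
    have nn: "\<And>k. 1 \<le> k \<Longrightarrow> 0 \<le> a k" using a by (auto simp: slowly_growing_def)
    show "lq_le q (\<lambda>j. a (2 ^ j)) (1 * R)"
      using True a(3) lq_bracket_le_iff[OF q a(2) nn] by (auto simp: lq_le_def)
  qed simp
next
  case False
  define p where "p = enn2real q"
  have p: "0 < p" unfolding p_def using enn2real_pos[OF q False] .
  show thesis
  proof (rule that[of "2 powr (1/p) * D"])
    show "0 < 2 powr (1/p) * D" using D by auto
    fix a R
    assume a: "slowly_growing D a" and R: "0 \<le> R" and le: "lq_bracket q a \<le> ennreal R"
    have nn: "\<And>k. 1 \<le> k \<Longrightarrow> 0 \<le> a k" using a by (auto simp: slowly_growing_def)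
    have le': "(\<Sum>k=1..n. a k powr p / real k) \<le> R powr p" for n
      using le False lq_bracket_le_iff[OF q R nn] by (auto simp: p_def)
    have ind: "(\<Sum>j<Suc n. a (2^j) powr p) \<le> 2 * D powr p * (\<Sum>k=1..2^n. a k powr p / real k)" for n
    proof (induction n)
      case 0
      have "1 * a 1 powr p \<le> (2 * D powr p) * a 1 powr p"
      proof (rule mult_right_mono)
        show "1 \<le> 2 * D powr p" using ge_one_powr_ge_zero[OF D, of p] p by linarith
      qed simp
      then show ?case by simp
    next
      case (Suc n)
      have "a (2^Suc n) powr p = (\<Sum>k=2^n+1..(2::nat)^Suc n. a (2^Suc n) powr p / 2^n)"
        by simp
      also have "\<dots> \<le> (\<Sum>k=2^n+1..2^Suc n. 2 * D powr p * (a k powr p / real k))"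
      proof (rule sum_mono)
        fix k :: nat assume k: "k \<in> {2^n+1..2^Suc n}"
        then have k1: "1 \<le> k" by auto
        have "a (2^Suc n) \<le> D * a k" using a k k1 unfolding slowly_growing_def by auto
        then have "a (2^Suc n) powr p \<le> (D * a k) powr p" using p nn by (intro powr_mono2) auto
        then have 1: "a (2^Suc n) powr p \<le> D powr p * a k powr p" using D nn k1 by (simp add: powr_mult)
        have "real k \<le> 2 * 2^n" using k by (metis atLeastAtMost_iff of_nat_le_iff of_nat_numeral of_nat_power power_Suc)
        then have 2: "1 / 2^n \<le> 2 / real k" using k1 by (simp add: field_simps)
        have "a (2^Suc n) powr p * (1 / 2^n) \<le> (D powr p * a k powr p) * (2 / real k)"
          by (rule mult_mono[OF 1 2]) auto
        then show "a (2^Suc n) powr p / 2^n \<le> 2 * D powr p * (a k powr p / real k)"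
          by (simp add: field_simps)
      qed
      also have "\<dots> = 2 * D powr p * (\<Sum>k=2^n+1..2^Suc n. a k powr p / real k)"
        by (simp add: sum_distrib_left)
      finally have step: "a (2^Suc n) powr p \<le> 2 * D powr p * (\<Sum>k=2^n+1..2^Suc n. a k powr p / real k)" .
      have "(\<Sum>k=1..2^Suc n. a k powr p / real k)
          = (\<Sum>k=1..2^n. a k powr p / real k) + (\<Sum>k=2^n+1..2^Suc n. a k powr p / real k)"
        by (rule sum.ub_add_nat[of 1 "2^n" _ "2^n", folded mult_2, folded power_Suc]) auto
      then show ?case using Suc.IH step by (simp add: algebra_simps)
    qed
    have "(\<Sum>j<n. a (2^j) powr p) \<le> (2 powr (1/p) * D * R) powr p" for n
    proof -
      have "(\<Sum>j<n. a (2^j) powr p) \<le> (\<Sum>j<Suc n. a (2^j) powr p)" by simp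
      also have "\<dots> \<le> 2 * D powr p * (\<Sum>k=1..2^n. a k powr p / real k)" by (rule ind)
      also have "\<dots> \<le> 2 * D powr p * R powr p" using le' by (intro mult_left_mono) auto
      also have "\<dots> = (2 powr (1/p) * D * R) powr p"
        using D R p by (simp add: powr_mult powr_powr)
      finally show ?thesis .
    qed
    then show "lq_le q (\<lambda>j. a (2 ^ j)) (2 powr (1/p) * D * R)"
      using False by (simp add: lq_le_def p_def)
  qed
qed

text \<open>A discrete Hardy inequality. The hypothesis on \<open>v\<close> says that \<open>v m\<close> is at most the supremum over \<open>i\<close> of
\<open>2\<^sup>-\<^sup>\<epsilon>\<^sup>i b(m + i)\<close>. For finite \<open>q\<close> the \<open>q\<close>-th power of that supremum is at most the sum of the \<open>q\<close>-th powers,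
and interchanging sums leaves a geometric series. With a supremum in place of a sum, all \<open>q > 0\<close> are handled in the same way,
below and above 1.\<close>

lemma lq_le_geometric_average:
  assumes q: "0 < q" and \<epsilon>: "0 < \<epsilon>"
  obtains C where "0 < C"
    "\<And>b v R. (\<And>j. 0 \<le> b j) \<Longrightarrow> 0 \<le> R \<Longrightarrow> lq_le q b R \<Longrightarrow> (\<And>m. 0 \<le> v m) \<Longrightarrow>
       (\<And>m T. (\<And>i. 2 powr (- \<epsilon> * real i) * b (m + i) \<le> T) \<Longrightarrow> v m \<le> T) \<Longrightarrow> lq_le q v (C * R)"
proof (cases "q = \<infinity>")
  case True
  show thesis
  proof (rule that[of 1])
    fix b v R
    assume b: "\<And>j. 0 \<le> (b j :: real)" "0 \<le> R" "lq_le q b R"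
      and v: "\<And>m T. (\<And>i. 2 powr (- \<epsilon> * real i) * b (m + i) \<le> T) \<Longrightarrow> v m \<le> T"
    have "v m \<le> R" for m
    proof (rule v)
      fix i
      have "2 powr (- \<epsilon> * real i) \<le> 2 powr 0" using \<epsilon> by (intro powr_mono) auto
      then have "2 powr (- \<epsilon> * real i) * b (m + i) \<le> 1 * b (m + i)"
        using b by (intro mult_right_mono) auto
      also have "\<dots> \<le> R" using b True by (simp add: lq_le_def)
      finally show "2 powr (- \<epsilon> * real i) * b (m + i) \<le> R" .
    qed
    then show "lq_le q v (1 * R)" using True by (simp add: lq_le_def)
  qed simp
next
  case False
  define p where "p = enn2real q"
  have p: "0 < p" unfolding p_def using enn2real_pos[OF q False] .
  define r :: real where "r = 2 powr (- \<epsilon> * p)"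
  have r: "0 < r" "r < 1" using \<epsilon> p by (auto simp: r_def powr_less_one)
  have ri: "(2 powr (- \<epsilon> * real i)) powr p = r ^ i" for i
    by (simp add: r_def powr_powr powr_power algebra_simps)
  show thesis
  proof (rule that[of "(1 / (1 - r)) powr (1 / p)"])
    show "0 < (1 / (1 - r)) powr (1 / p)" using r by auto
    fix b v R
    assume b: "\<And>j. 0 \<le> (b j :: real)" and R: "0 \<le> R" and le: "lq_le q b R"
      and v0: "\<And>m. 0 \<le> (v m :: real)"
      and v: "\<And>m T. (\<And>i. 2 powr (- \<epsilon> * real i) * b (m + i) \<le> T) \<Longrightarrow> v m \<le> T"
    have le': "(\<Sum>j<n. b j powr p) \<le> R powr p" for n
      using le False by (simp add: lq_le_def p_def)
    have bR: "b j \<le> R" for j by (rule lq_le_pointwise[OF q R b le])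
    have bRp: "b j powr p \<le> R powr p" for j using bR b p by (intro powr_mono2) auto
    define w where "w m i = r ^ i * b (m + i) powr p" for m i
    have w0: "0 \<le> w m i" for m i using r by (simp add: w_def)
    have geo: "summable (\<lambda>i. r ^ i * R powr p)"
      using r by (intro summable_mult2 summable_geometric) auto
    have sw: "summable (w m)" for m
    proof (rule summable_comparison_test'[OF geo])
      fix i :: nat
      show "norm (w m i) \<le> r ^ i * R powr p"
        using r bRp[of "m+i"] by (simp add: w_def)
    qed
    have vw: "v m powr p \<le> suminf (w m)" for m
    proof -
      define T where "T = suminf (w m) powr (1/p)"
      have "v m \<le> T"
      proof (rule v)
        fix i
        have "(2 powr (- \<epsilon> * real i) * b (m + i)) powr p = w m i"
          using b by (simp only: powr_mult ri w_def)
        also have "\<dots> \<le> suminf (w m)"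
          using sum_le_suminf[OF sw, of "{i}" m] w0 by auto
        finally have "((2 powr (- \<epsilon> * real i) * b (m + i)) powr p) powr (1/p) \<le> T"
          unfolding T_def using p by (intro powr_mono2) auto
        then show "2 powr (- \<epsilon> * real i) * b (m + i) \<le> T"
          using b p by (simp add: powr_powr)
      qed
      then have "v m powr p \<le> T powr p" using p v0 by (intro powr_mono2) auto
      also have "\<dots> = suminf (w m)" unfolding T_def using p sw w0 by (simp add: powr_powr suminf_nonneg)
      finally show ?thesis .
    qed
    have "(\<Sum>m<n. v m powr p) \<le> ((1 / (1 - r)) powr (1 / p) * R) powr p" for n
    proof -
      have "(\<Sum>m<n. v m powr p) \<le> (\<Sum>m<n. suminf (w m))" by (intro sum_mono vw)
      also have "\<dots> = (\<Sum>i. \<Sum>m<n. w m i)" by (rule suminf_sum[symmetric]) (rule sw)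
      also have "\<dots> \<le> (\<Sum>i. r ^ i * R powr p)"
      proof (rule suminf_le[OF _ summable_sum geo])
        fix i
        have "(\<Sum>m<n. b (m + i) powr p) = (\<Sum>j=i..<n+i. b j powr p)"
          using sum.shift_bounds_nat_ivl[of "\<lambda>j. b j powr p" 0 i n] by (simp add: lessThan_atLeast0)
        also have "\<dots> \<le> (\<Sum>j<n+i. b j powr p)" by (rule sum_mono2) auto
        also have "\<dots> \<le> R powr p" by (rule le')
        finally show "(\<Sum>m<n. w m i) \<le> r ^ i * R powr p"
          using r by (simp add: w_def sum_distrib_left[symmetric])
      qed (rule sw)
      also have "\<dots> = 1 / (1 - r) * R powr p"
        using r by (subst suminf_mult2[symmetric]) (auto simp: suminf_geometric summable_geometric)
      also have "\<dots> = ((1 / (1 - r)) powr (1 / p) * R) powr p"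
        using r R p by (simp add: powr_mult powr_powr)
      finally show ?thesis .
    qed
    then show "lq_le q v ((1 / (1 - r)) powr (1 / p) * R)"
      using False by (simp add: lq_le_def p_def)
  qed
qed

text \<open>This is the Hardy inequality for a sequence \<open>b\<close> supported at the single index \<open>J\<close>: a sequence that decays geometrically
from \<open>J\<close> downwards is controlled by its largest value.\<close>

lemma lq_le_geometric_tail:
  assumes q: "0 < q" and \<epsilon>: "0 < \<epsilon>"
  obtains C where "0 < C"
    "\<And>v J R. 0 \<le> R \<Longrightarrow> (\<And>j. 0 \<le> v j) \<Longrightarrow> (\<And>j. j \<le> J \<Longrightarrow> v j \<le> 2 powr (- \<epsilon> * real (J - j)) * R) \<Longrightarrow>
       (\<And>j. J < j \<Longrightarrow> v j = 0) \<Longrightarrow> lq_le q v (C * R)"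
proof -
  obtain C where C: "0 < C" and H:
    "\<And>b v R. (\<And>j. 0 \<le> b j) \<Longrightarrow> 0 \<le> R \<Longrightarrow> lq_le q b R \<Longrightarrow> (\<And>m. 0 \<le> v m) \<Longrightarrow>
       (\<And>m T. (\<And>i. 2 powr (- \<epsilon> * real i) * b (m + i) \<le> T) \<Longrightarrow> v m \<le> T) \<Longrightarrow> lq_le q v (C * R)"
    using lq_le_geometric_average[OF assms] by metis
  show thesis
  proof (rule that[OF C])
    fix v :: "nat \<Rightarrow> real" and J :: nat and R :: real
    assume R: "0 \<le> R" and v0: "\<And>j. 0 \<le> v j"
      and v: "\<And>j. j \<le> J \<Longrightarrow> v j \<le> 2 powr (- \<epsilon> * real (J - j)) * R"
      and vJ: "\<And>j. J < j \<Longrightarrow> v j = 0"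
    define b where "b j = (if j = J then R else 0)" for j
    show "lq_le q v (C * R)"
    proof (rule H[of b])
      show "lq_le q b R"
      proof (cases "q = \<infinity>")
        case False
        have "(\<Sum>j<n. b j powr enn2real q) = (\<Sum>j<n. if j = J then R powr enn2real q else 0)" for n
          by (rule sum.cong) (auto simp: b_def)
        then show ?thesis using False by (auto simp: lq_le_def)
      qed (use R in \<open>auto simp: lq_le_def b_def\<close>)
      fix m T
      assume T: "\<And>i. 2 powr (- \<epsilon> * real i) * b (m + i) \<le> T"
      show "v m \<le> T"
      proof (cases "m \<le> J")
        case True
        then show ?thesis using v[OF True] T[of "J - m"] by (simp add: b_def)
      next
        case False
        then show ?thesis using vJ[of m] T[of 0] by (simp add: b_def)
      qed
    qed (use R v0 in \<open>auto simp: b_def\<close>)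
  qed
qed

text \<open>The two summands in the \<open>q\<close>-th power, one for the first entry and one for the tail, account for the factor \<open>2\<^sup>1\<^sup>/\<^sup>q\<close>.
For \<open>q = \<infinity>\<close> the exponent is \<open>1 / enn2real \<infinity> = 0\<close> and the factor is 1.\<close>

lemma lq_le_cons:
  assumes "0 < q" "0 \<le> R" "\<And>j. 0 \<le> u j" "u 0 \<le> R" "lq_le q (\<lambda>j. u (Suc j)) R"
  shows "lq_le q u (2 powr (1 / enn2real q) * R)"
proof (cases "q = \<infinity>")
  case True
  have "u j \<le> R" for j using assms True by (cases j) (auto simp: lq_le_def)
  then show ?thesis using True by (simp add: lq_le_def)
next
  case False
  define p where "p = enn2real q"
  have p: "0 < p" unfolding p_def using enn2real_pos[OF assms(1) False] .
  have "(\<Sum>j<n. u j powr p) \<le> (2 powr (1 / p) * R) powr p" for n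
  proof -
    have "(\<Sum>j<n. u j powr p) \<le> (\<Sum>j<Suc n. u j powr p)" by simp
    also have "\<dots> = u 0 powr p + (\<Sum>j<n. u (Suc j) powr p)" by (rule sum.lessThan_Suc_shift)
    also have "\<dots> \<le> R powr p + R powr p"
      using assms p False by (intro add_mono powr_mono2) (auto simp: lq_le_def p_def)
    also have "\<dots> = (2 powr (1 / p) * R) powr p" using assms p by (simp add: powr_mult powr_powr)
    finally show ?thesis .
  qed
  then show ?thesis using False by (simp add: lq_le_def p_def)
qed

section \<open>Weights\<close>

lemma incr_weight_mono:
  assumes "incr_weight \<eta>" "1 \<le> k" "k \<le> l"
  shows "\<eta> k \<le> \<eta> l"
  using assms(3)
proof (induction l rule: dec_induct)
  case (step n)
  then show ?case using assms unfolding incr_weight_def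
    by (metis Suc_eq_plus1 order_trans)
qed simp

text \<open>Iterating \<open>\<eta>(k) \<le> \<delta> \<eta>(\<kappa>k)\<close> with \<open>\<delta> = M\<^sub>\<eta>(\<kappa>) < 1\<close> gives geometric growth along the powers of \<open>\<kappa>\<close>; monotonicity of \<open>\<eta>\<close>
transfers it to the powers of two, at the cost of a constant.\<close>

lemma dyadic_growth_if_dil_less_1:
  assumes pos: "\<And>k. 1 \<le> k \<Longrightarrow> 0 < \<eta> k" and inc: "incr_weight \<eta>"
    and \<kappa>: "1 < \<kappa>" and dil: "dil \<eta> \<kappa> < 1"
  obtains C \<epsilon> where "0 < C" "0 < \<epsilon>"
    "\<And>j J. j \<le> J \<Longrightarrow> \<eta> (2 ^ j) \<le> C * 2 powr (- \<epsilon> * real (J - j)) * \<eta> (2 ^ J)"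
proof -
  define \<delta> where "\<delta> = dil \<eta> \<kappa>"
  have bdd: "bdd_above ((\<lambda>k. \<eta> k / \<eta> (\<kappa> * k)) ` {1..})"
  proof (rule bdd_aboveI2)
    fix k :: nat assume "k \<in> {1..}"
    then show "\<eta> k / \<eta> (\<kappa> * k) \<le> 1"
      using pos[of k] pos[of "\<kappa>*k"] incr_weight_mono[OF inc, of k "\<kappa>*k"] \<kappa> by auto
  qed
  have q: "\<eta> k / \<eta> (\<kappa> * k) \<le> \<delta>" if "1 \<le> k" for k
    unfolding \<delta>_def dil_def using that by (intro cSUP_upper[OF _ bdd]) auto
  have d0: "0 < \<delta>" using q[of 1] pos[of 1] pos[of "\<kappa>"] \<kappa>
    by (smt (verit) divide_pos_pos le_numeral_extra(4) less_imp_le_nat mult.right_neutral)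
  have d1: "\<delta> < 1" using dil by (simp add: \<delta>_def)
  \<comment> \<open>Any \<open>m\<close> with \<open>\<kappa> \<le> 2\<^sup>m\<close> serves; \<open>\<epsilon>\<close> below is chosen such that \<open>2\<^sup>-\<^sup>\<epsilon>\<^sup>m = \<delta>\<close>.\<close>
  define m where "m = \<kappa>"
  have m: "1 \<le> m" "\<kappa> \<le> 2 ^ m" using \<kappa> by (auto simp: m_def less_imp_le)
  have step: "\<eta> (2 ^ j) \<le> \<delta> * \<eta> (2 ^ (j + m))" for j
  proof -
    have "\<eta> (2^j) \<le> \<delta> * \<eta> (\<kappa> * 2^j)"
      using q[of "2^j"] pos[of "\<kappa> * 2^j"] \<kappa> by (simp add: field_simps)
    also have "\<dots> \<le> \<delta> * \<eta> (2 ^ (j + m))"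
      using d0 m \<kappa> by (intro mult_left_mono incr_weight_mono[OF inc]) (auto simp: power_add)
    finally show ?thesis .
  qed
  define \<epsilon> where "\<epsilon> = - log 2 \<delta> / real m"
  have "log 2 \<delta> < 0" using d0 d1 by simp
  then have e0: "0 < \<epsilon>" using m by (simp add: \<epsilon>_def divide_neg_pos)
  have em: "2 powr (- \<epsilon> * real m) = \<delta>" using m d0 by (simp add: \<epsilon>_def)
  show thesis
  proof (rule that[of "1 / \<delta>" \<epsilon>])
    fix j J :: nat assume "j \<le> J"
    then show "\<eta> (2 ^ j) \<le> 1 / \<delta> * 2 powr (- \<epsilon> * real (J - j)) * \<eta> (2 ^ J)"
    proof (induction "J - j" arbitrary: j rule: less_induct)
      case less
      show ?case
      proof (cases "J - j < m")
        case True
        have "\<delta> \<le> 2 powr (- \<epsilon> * real (J - j))"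
          unfolding em[symmetric] using e0 True by (intro powr_mono) auto
        then have "1 * \<eta> (2^J) \<le> (1 / \<delta> * 2 powr (- \<epsilon> * real (J - j))) * \<eta> (2 ^ J)"
          using d0 pos[of "2^J"] by (intro mult_right_mono) (auto simp: field_simps)
        moreover have "\<eta> (2^j) \<le> \<eta> (2^J)"
          using less.prems by (intro incr_weight_mono[OF inc]) auto
        ultimately show ?thesis by simp
      next
        case False
        have "\<eta> (2 ^ j) \<le> \<delta> * \<eta> (2 ^ (j + m))" by (rule step)
        also have "\<dots> \<le> \<delta> * (1 / \<delta> * 2 powr (- \<epsilon> * real (J - (j + m))) * \<eta> (2 ^ J))"
          using False m d0 by (intro mult_left_mono less.hyps) auto
        also have "\<dots> = 1 / \<delta> * (2 powr (- \<epsilon> * real m) * 2 powr (- \<epsilon> * real (J - (j + m)))) * \<eta> (2 ^ J)"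
          unfolding em by simp
        also have "2 powr (- \<epsilon> * real m) * 2 powr (- \<epsilon> * real (J - (j + m))) = 2 powr (- \<epsilon> * real (J - j))"
        proof -
          have "real (J - j) = real m + real (J - (j + m))" using False by simp
          then show ?thesis by (simp add: powr_add[symmetric] algebra_simps)
        qed
        finally show ?thesis .
      qed
    qed
  qed (use d0 e0 in auto)
qed

text \<open>It suffices to compare at powers of two if the left-hand side cannot jump up and the right-hand side cannot drop within a
dyadic block.\<close>

lemma lesssim_if_dyadic:
  assumes F: "slowly_growing D F" and D: "0 < D" and G: "incr_weight G"
    and C: "0 < C" and le: "\<And>j. F (2 ^ j) \<le> C * G (2 ^ j)"
  shows "lesssim F G"
  unfolding lesssim_def
proof (intro exI conjI allI impI)
  show "0 < D * C" using D C by simp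
  fix k :: nat assume k: "1 \<le> k"
  obtain j where j: "2^j \<le> k" "k < 2^Suc j" using ex_power_ivl1[of 2 k] k by auto
  have "F k \<le> D * F (2^j)" using F j unfolding slowly_growing_def by auto
  also have "\<dots> \<le> D * (C * G (2^j))" using le D by (intro mult_left_mono) auto
  also have "\<dots> \<le> D * (C * G k)" using D C j by (intro mult_left_mono incr_weight_mono[OF G]) auto
  finally show "F k \<le> D * C * G k" by (simp add: mult.assoc)
qed

lemma slowly_growing_if_doubling:
  assumes "incr_weight \<eta>" "doubling \<eta>" "\<And>k. 1 \<le> k \<Longrightarrow> 0 \<le> \<eta> k"
  obtains D where "1 \<le> D" "slowly_growing D \<eta>"
proof -
  obtain C where C: "0 < C" "\<And>k. 1 \<le> k \<Longrightarrow> \<eta> (2 * k) \<le> C * \<eta> k"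
    using assms(2) unfolding doubling_def by blast
  show thesis
  proof (rule that[of "max 1 C"])
    show "slowly_growing (max 1 C) \<eta>" unfolding slowly_growing_def
    proof (intro allI impI conjI)
      fix k l :: nat assume k: "1 \<le> k" and l: "k \<le> l \<and> l \<le> 2 * k"
      have "\<eta> l \<le> \<eta> (2*k)" using k l by (intro incr_weight_mono[OF assms(1)]) auto
      also have "\<dots> \<le> C * \<eta> k" using C k by auto
      also have "\<dots> \<le> max 1 C * \<eta> k" using assms(3) k by (intro mult_right_mono) auto
      finally show "\<eta> l \<le> max 1 C * \<eta> k" .
    qed (use assms in auto)
  qed simp
qed

lemma slowly_growing_mult:
  assumes "slowly_growing D a" "slowly_growing E b" "0 \<le> D" "0 \<le> E"
  shows "slowly_growing (D * E) (\<lambda>k. a k * b k)"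
  unfolding slowly_growing_def
proof (intro allI impI conjI)
  fix k l :: nat assume k: "1 \<le> k" and l: "k \<le> l \<and> l \<le> 2 * k"
  have "a l * b l \<le> (D * a k) * (E * b k)"
    using assms k l unfolding slowly_growing_def by (intro mult_mono) auto
  then show "a l * b l \<le> D * E * (a k * b k)" by (simp add: algebra_simps)
qed (use assms in \<open>auto simp: slowly_growing_def\<close>)

lemma slowly_growing_if_decreasing:
  assumes "\<And>k. 1 \<le> k \<Longrightarrow> 0 \<le> a k" "\<And>k l. 1 \<le> k \<Longrightarrow> k \<le> l \<Longrightarrow> a l \<le> a k"
  shows "slowly_growing 1 a"
  using assms by (auto simp: slowly_growing_def)

lemma slowly_growing_powr:
  assumes "0 \<le> \<alpha>" shows "slowly_growing (2 powr \<alpha>) (\<lambda>k. real k powr \<alpha>)"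
  unfolding slowly_growing_def
proof (intro allI impI conjI)
  fix k l :: nat assume k: "1 \<le> k" and l: "k \<le> l \<and> l \<le> 2 * k"
  have "real l powr \<alpha> \<le> (2 * real k) powr \<alpha>" using assms l by (intro powr_mono2) auto
  then show "real l powr \<alpha> \<le> 2 powr \<alpha> * real k powr \<alpha>" by (simp add: powr_mult)
qed auto

text \<open>A quotient with positive value in the definition of \<open>i\<^sub>\<eta>\<close> has \<open>ln M\<^sub>\<eta>(m) < 0\<close>. Since \<open>M\<^sub>\<eta>(m) > 0\<close>, the logarithm is a genuine
one, and \<open>M\<^sub>\<eta>(m) < 1\<close>.\<close>

lemma dil_less_1_if_lower_index_pos:
  assumes pos: "\<And>k. 1 \<le> k \<Longrightarrow> 0 < \<eta> k" and inc: "incr_weight \<eta>" and idx: "0 < lower_index \<eta>"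
  shows "\<exists>m>1. dil \<eta> m < 1"
proof -
  obtain m where m: "m \<in> {2..}" "0 < ereal (ln (dil \<eta> m) / (- ln (real m)))"
    using idx unfolding lower_index_def less_SUP_iff by blast
  have "0 < ln (real m)" using m by simp
  then have "ln (dil \<eta> m) < 0" using m(2)
    by (auto simp: divide_less_0_iff)
  moreover have "0 < dil \<eta> m"
  proof -
    have "bdd_above ((\<lambda>k. \<eta> k / \<eta> (m * k)) ` {1..})"
    proof (rule bdd_aboveI2)
      fix k :: nat assume "k \<in> {1..}"
      then show "\<eta> k / \<eta> (m * k) \<le> 1"
        using pos[of k] pos[of "m*k"] incr_weight_mono[OF inc, of k "m*k"] m by auto
    qed
    then have "\<eta> 1 / \<eta> (m * 1) \<le> dil \<eta> m" unfolding dil_def by (intro cSUP_upper) auto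
    moreover have "0 < \<eta> 1 / \<eta> (m * 1)" using pos[of 1] pos[of m] m by simp
    ultimately show ?thesis by linarith
  qed
  ultimately have "dil \<eta> m < 1" by simp
  then show ?thesis using m by (intro exI[of _ m]) auto
qed

lemma weightsD:
  assumes "\<omega> \<in> weights"
  shows "\<And>k. 1 \<le> k \<Longrightarrow> 0 < \<omega> k" "incr_weight \<omega>" "doubling \<omega>"
  using assms by (auto simp: weights_def)

section \<open>Decreasing rearrangements\<close>

text \<open>Boundedness keeps the infimum that defines the rearrangement from being taken over the empty set.\<close>

lemma decr_rearr_set_nonempty:
  assumes "\<And>j. norm (s j) \<le> B" "1 \<le> k"
  shows "\<exists>t. 0 \<le> t \<and> finite {j. t < norm (s j)} \<and> card {j. t < norm (s j)} < k"
proof -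
  have "{j. max 0 B < norm (s j)} = {}" using assms(1) by (auto simp: not_less le_max_iff_disj)
  then have "finite {j. max 0 B < norm (s j)}" "card {j. max 0 B < norm (s j)} < k"
    using assms(2) by (simp_all del: max_less_iff_conj)
  then show ?thesis by (intro exI[of _ "max 0 B"] conjI) auto
qed

lemma decr_rearr_nonneg:
  assumes "\<And>j. norm (s j) \<le> B" "1 \<le> k"
  shows "0 \<le> decr_rearr s k"
  unfolding decr_rearr_def using decr_rearr_set_nonempty[of s, OF assms]
  by (intro cInf_greatest) auto

lemma decr_rearr_le:
  assumes "0 \<le> t" "finite {j. t < norm (s j)}" "card {j. t < norm (s j)} < k"
  shows "decr_rearr s k \<le> t"
  unfolding decr_rearr_def using assms by (intro cInf_lower bdd_belowI[of _ 0]) auto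

lemma decr_rearr_antimono:
  assumes "\<And>j. norm (s j) \<le> B" "1 \<le> k" "k \<le> l"
  shows "decr_rearr s l \<le> decr_rearr s k"
  unfolding decr_rearr_def using decr_rearr_set_nonempty[of s, OF assms(1,2)] assms(3)
  by (intro cInf_superset_mono bdd_belowI[of _ 0]) auto

text \<open>The infimum that defines the rearrangement is attained: otherwise \<open>k\<close> entries exceed it, and so does the least of these
entries, which then lies above an admissible level that fewer than \<open>k\<close> entries exceed.\<close>

lemma card_gt_decr_rearr:
  assumes B: "\<And>j. norm (s j) \<le> B" and k: "1 \<le> k"
  shows "finite {j. decr_rearr s k < norm (s j)} \<and> card {j. decr_rearr s k < norm (s j)} < k"
proof (rule ccontr)
  let ?d = "decr_rearr s k"
  assume "\<not> ?thesis"
  then obtain F where F: "finite F" "card F = k" "F \<subseteq> {j. ?d < norm (s j)}"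
    by (metis infinite_arbitrarily_large not_less obtain_subset_with_card_n)
  have ne: "F \<noteq> {}" using F k by auto
  define m where "m = Min ((\<lambda>j. norm (s j)) ` F)"
  have "?d < m" using F ne by (auto simp: m_def)
  then obtain t where t: "0 \<le> t" "finite {j. t < norm (s j)}" "card {j. t < norm (s j)} < k" "t < m"
    using cInf_lessD[of "{t. 0 \<le> t \<and> finite {j. t < norm (s j)} \<and> card {j. t < norm (s j)} < k}" m]
      decr_rearr_set_nonempty[of s, OF assms] by (auto simp: decr_rearr_def)
  have "F \<subseteq> {j. t < norm (s j)}" using t(4) F(1) ne by (auto simp: m_def)
  then have "card F \<le> card {j. t < norm (s j)}" using t(2) by (rule card_mono[rotated])
  then show False using F t by simp
qed

text \<open>A level below the infimum is not admissible, so infinitely many or at least \<open>k\<close> entries exceed it.\<close>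

lemma subset_above_if_less_decr_rearr:
  assumes "0 \<le> t" "t < decr_rearr s k"
  shows "\<exists>F. finite F \<and> card F = k \<and> (\<forall>j\<in>F. t < norm (s j))"
proof -
  have "infinite {j. t < norm (s j)} \<or> k \<le> card {j. t < norm (s j)}"
    using decr_rearr_le[of t s k] assms by fastforce
  then obtain F where "finite F" "card F = k" "F \<subseteq> {j. t < norm (s j)}"
    by (metis infinite_arbitrarily_large obtain_subset_with_card_n)
  then show ?thesis by auto
qed

lemma decr_rearr_indicator:
  assumes "finite \<Gamma>" "1 \<le> k"
  shows "decr_rearr (\<lambda>j. if j \<in> \<Gamma> then 1 else 0 :: 'k::real_normed_field) k
    = (if k \<le> card \<Gamma> then 1 else 0)"
proof -
  let ?s = "\<lambda>j. if j \<in> \<Gamma> then 1 else 0 :: 'k"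
  have "{j. t < norm (?s j)} = (if t < 1 then \<Gamma> else {})" if "0 \<le> t" for t
    using that by auto
  then have "0 \<le> t \<and> finite {j. t < norm (?s j)} \<and> card {j. t < norm (?s j)} < k
      \<longleftrightarrow> 0 \<le> t \<and> (1 \<le> t \<or> card \<Gamma> < k)" for t
    using assms by (cases "0 \<le> t") simp_all
  then have "{t. 0 \<le> t \<and> finite {j. t < norm (?s j)} \<and> card {j. t < norm (?s j)} < k}
      = {t. 0 \<le> t \<and> (1 \<le> t \<or> card \<Gamma> < k)}"
    by (rule Collect_cong)
  also have "\<dots> = (if k \<le> card \<Gamma> then {1..} else {0..})" by auto
  finally show ?thesis unfolding decr_rearr_def by simp
qed

section \<open>Continuous embeddings\<close>

text \<open>Bounds by real numbers replace the extended norms, in the form in which all estimates here are proved.\<close>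

lemma embedsI:
  assumes "0 < C" "\<And>x R. 0 \<le> R \<Longrightarrow> nX x \<le> ennreal R \<Longrightarrow> nY x \<le> ennreal (C * R)"
  shows "embeds nX nY"
proof -
  have *: "nY x \<le> ennreal C * nX x \<and> nY x < \<infinity>" if "nX x < \<infinity>" for x
  proof -
    obtain R where R: "0 \<le> R" "nX x = ennreal R" using \<open>nX x < \<infinity>\<close> by (cases "nX x") auto
    then have "nY x \<le> ennreal (C * R)" using assms(2) by simp
    moreover have "ennreal (C * R) = ennreal C * nX x" using R assms(1) by (simp add: ennreal_mult)
    ultimately show ?thesis by (metis ennreal_less_top infinity_ennreal_def le_less_trans)
  qed
  then show ?thesis unfolding embeds_def space_of_def using assms(1) by blast
qed

lemma embedsE:
  assumes "embeds nX nY"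
  obtains C where "0 < C" "\<And>x R. 0 \<le> R \<Longrightarrow> nX x \<le> ennreal R \<Longrightarrow> nY x \<le> ennreal (C * R)"
proof -
  obtain C where C: "0 < C" "\<And>x. x \<in> space_of nX \<Longrightarrow> nY x \<le> ennreal C * nX x"
    using assms unfolding embeds_def by blast
  show thesis
  proof (rule that[OF C(1)])
    fix x and R :: real assume R: "0 \<le> R" "nX x \<le> ennreal R"
    then have "x \<in> space_of nX" unfolding space_of_def
      by (metis CollectI ennreal_less_top infinity_ennreal_def le_less_trans)
    then have "nY x \<le> ennreal C * nX x" by (rule C)
    also have "\<dots> \<le> ennreal C * ennreal R" using R by (intro mult_left_mono) auto
    also have "\<dots> = ennreal (C * R)" using R C by (simp add: ennreal_mult)
    finally show "nY x \<le> ennreal (C * R)" .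
  qed
qed

section \<open>Normalized unconditional bases\<close>

locale normalized_unconditional_basis = quasi_banach sc qn \<rho>
  for sc :: "'k::real_normed_field \<Rightarrow> 'a::ab_group_add \<Rightarrow> 'a" and qn :: "'a \<Rightarrow> real" and \<rho> :: real +
  fixes e :: "nat \<Rightarrow> 'a"
  assumes unconditional: "unconditional_basis sc qn e 1"
    and qn_e: "qn (e j) = 1"
begin

abbreviation "hr \<equiv> h_right qn e"
abbreviation "hl \<equiv> h_left qn e"
abbreviation "coef \<equiv> coeffs sc qn e"
abbreviation "err \<equiv> approx_error sc qn e"

definition fin_comb :: "nat set \<Rightarrow> (nat \<Rightarrow> 'k) \<Rightarrow> 'a" where
  "fin_comb F c = (\<Sum>j\<in>F. sc (c j) (e j))"

definition ind :: "nat set \<Rightarrow> 'a" where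
  "ind \<Gamma> = (\<Sum>k\<in>\<Gamma>. e k)"

lemma ind_eq_fin_comb: "ind \<Gamma> = fin_comb \<Gamma> (\<lambda>_. 1)"
  by (simp add: ind_def fin_comb_def)

lemma qn_0 [simp]: "qn 0 = 0"
  by (simp add: qn_eq_0_iff)

lemma qn_minus [simp]: "qn (- x) = qn x"
  using qn_scale[of "-1" x] by simp

lemma qn_powr_le_cancel: "qn x powr \<rho> \<le> R powr \<rho> \<Longrightarrow> 0 \<le> R \<Longrightarrow> qn x \<le> R"
  using rho_pos qn_nonneg by (meson powr_less_mono2 not_le)

lemma qn_sum:
  "finite F \<Longrightarrow> qn (\<Sum>i\<in>F. f i) powr \<rho> \<le> (\<Sum>i\<in>F. qn (f i) powr \<rho>)"
proof (induction F rule: finite_induct)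
  case (insert i F)
  then show ?case using qn_triangle[of "f i" "\<Sum>i\<in>F. f i"] by simp
qed simp

lemma ex1_expands: "\<exists>!c. expands sc qn e c x"
  using unconditional unfolding unconditional_basis_def basis_def by blast

lemma coef_eqI: "expands sc qn e c x \<Longrightarrow> coef x = c"
  unfolding coeffs_def using ex1_expands by (rule the1_equality)

lemma expands_coef: "expands sc qn e (coef x) x"
  unfolding coeffs_def using ex1_expands by (rule theI')

lemma expands_fin_comb:
  assumes "finite F"
  shows "expands sc qn e (\<lambda>j. if j \<in> F then c j else 0) (fin_comb F c)"
proof -
  obtain m where m: "F \<subseteq> {..<m}" using assms finite_nat_iff_bounded by blast
  have "(\<Sum>j<n. sc (if j \<in> F then c j else 0) (e j)) = fin_comb F c" if "m \<le> n" for n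
    unfolding fin_comb_def using m that by (intro sum.mono_neutral_cong_right) auto
  then have "eventually (\<lambda>n. qn (fin_comb F c - (\<Sum>j<n. sc (if j \<in> F then c j else 0) (e j))) = 0) sequentially"
    unfolding eventually_sequentially by (intro exI[of _ m]) auto
  then show ?thesis unfolding expands_def by (rule tendsto_eventually)
qed

lemma coef_fin_comb: "finite F \<Longrightarrow> coef (fin_comb F c) = (\<lambda>j. if j \<in> F then c j else 0)"
  by (rule coef_eqI[OF expands_fin_comb])

lemma coef_ind: "finite \<Gamma> \<Longrightarrow> coef (ind \<Gamma>) = (\<lambda>j. if j \<in> \<Gamma> then 1 else 0)"
  by (simp add: ind_eq_fin_comb coef_fin_comb)

lemma tendsto_qn_powr: "(\<lambda>n. qn (f n)) \<longlonglongrightarrow> 0 \<Longrightarrow> (\<lambda>n. qn (f n) powr \<rho>) \<longlonglongrightarrow> 0"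
  using tendsto_powr'[of "\<lambda>n. qn (f n)" 0 sequentially "\<lambda>_. \<rho>" \<rho>] rho_pos qn_nonneg by simp

lemma expands_diff:
  assumes "expands sc qn e c x" "expands sc qn e d y"
  shows "expands sc qn e (\<lambda>j. c j - d j) (x - y)"
proof -
  define u where "u n = x - (\<Sum>j<n. sc (c j) (e j))" for n
  define v where "v n = y - (\<Sum>j<n. sc (d j) (e j))" for n
  have w: "x - y - (\<Sum>j<n. sc (c j - d j) (e j)) = u n + - v n" for n
    by (simp add: u_def v_def scale_left_diff_distrib sum_subtractf)
  have lim: "(\<lambda>n. qn (u n) powr \<rho> + qn (v n) powr \<rho>) \<longlonglongrightarrow> 0"
    using tendsto_add[OF tendsto_qn_powr tendsto_qn_powr] assms
    unfolding expands_def u_def v_def by fastforce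
  have "(\<lambda>n. qn (u n + - v n) powr \<rho>) \<longlonglongrightarrow> 0"
  proof (rule tendsto_sandwich[OF _ _ tendsto_const lim])
    show "\<forall>\<^sub>F n in sequentially. qn (u n + - v n) powr \<rho> \<le> qn (u n) powr \<rho> + qn (v n) powr \<rho>"
      using qn_triangle[of "u n" "- v n" for n] by (auto intro!: always_eventually)
  qed auto
  then have "(\<lambda>n. (qn (u n + - v n) powr \<rho>) powr (1/\<rho>)) \<longlonglongrightarrow> 0 powr (1/\<rho>)"
    using rho_pos by (intro tendsto_powr') auto
  then show ?thesis unfolding expands_def w using rho_pos qn_nonneg by (simp add: powr_powr)
qed

lemma coef_diff: "coef (x - y) = (\<lambda>j. coef x j - coef y j)"
  by (rule coef_eqI[OF expands_diff]) (rule expands_coef)+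

text \<open>The lattice property of an unconditional basis with constant 1. The multipliers are the quotients of the coefficients. They give
a vector with the coefficients of \<open>y\<close>, which is \<open>y\<close> itself because the zero expansion determines the zero vector.\<close>

lemma qn_mono_coef:
  assumes "\<And>j. norm (coef y j) \<le> norm (coef x j)"
  shows "qn y \<le> qn x"
proof -
  define \<mu> where "\<mu> j = coef y j / coef x j" for j
  have \<mu>: "\<And>j. norm (\<mu> j) \<le> 1" using assms
    by (auto simp: \<mu>_def norm_divide divide_le_eq_1)
  have "(\<lambda>j. \<mu> j * coef x j) = coef y"
  proof
    fix j show "\<mu> j * coef x j = coef y j" using assms[of j] by (cases "coef x j = 0") (auto simp: \<mu>_def)
  qed
  then obtain z where z: "expands sc qn e (coef y) z" "qn z \<le> 1 * qn x"
    using unconditional expands_coef[of x] \<mu> unfolding unconditional_basis_def by metis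
  have "(\<lambda>j. coef z j - coef y j) = (\<lambda>j. 0)" using coef_eqI[OF z(1)] by simp
  then have "expands sc qn e (\<lambda>j. 0) (z - y)" using expands_coef[of "z - y"] by (simp add: coef_diff)
  then have "qn (z - y) = 0" unfolding expands_def by (simp add: LIMSEQ_const_iff)
  then have "z = y" by (simp add: qn_eq_0_iff)
  then show ?thesis using z by simp
qed

lemma qn_fin_comb_mono:
  assumes "finite G" "F \<subseteq> G" "\<And>j. j \<in> F \<Longrightarrow> norm (c j) \<le> norm (d j)"
  shows "qn (fin_comb F c) \<le> qn (fin_comb G d)"
  using assms by (intro qn_mono_coef) (auto simp: coef_fin_comb finite_subset)

lemma qn_ind_mono: "finite G \<Longrightarrow> F \<subseteq> G \<Longrightarrow> qn (ind F) \<le> qn (ind G)"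
  unfolding ind_eq_fin_comb by (rule qn_fin_comb_mono) auto

lemma qn_ind_ge_1:
  assumes "finite \<Gamma>" "\<Gamma> \<noteq> {}"
  shows "1 \<le> qn (ind \<Gamma>)"
proof -
  obtain k where "k \<in> \<Gamma>" using assms by auto
  then show ?thesis using qn_ind_mono[of \<Gamma> "{k}"] assms qn_e by (simp add: ind_def)
qed

lemma qn_ind_Un:
  assumes "finite \<Gamma>" "\<Gamma>' \<subseteq> \<Gamma>"
  shows "qn (ind \<Gamma>) powr \<rho> \<le> qn (ind \<Gamma>') powr \<rho> + qn (ind (\<Gamma> - \<Gamma>')) powr \<rho>"
  using qn_triangle[of "ind \<Gamma>'" "ind (\<Gamma> - \<Gamma>')"] sum.subset_diff[OF assms(2,1), of e]
  by (simp add: ind_def add.commute)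

lemma qn_ind_powr_le_card: "finite \<Gamma> \<Longrightarrow> qn (ind \<Gamma>) powr \<rho> \<le> real (card \<Gamma>)"
  using qn_sum[of \<Gamma> e] by (simp add: ind_def qn_e)

lemma norm_coef_le: "norm (coef x j) \<le> qn x"
proof -
  have "qn (fin_comb {j} (coef x)) \<le> qn x"
    by (rule qn_mono_coef) (auto simp: coef_fin_comb)
  then show ?thesis by (simp add: fin_comb_def qn_scale qn_e)
qed

text \<open>The \<open>n\<close>-th coefficient of \<open>x\<close> is also that of the tail of the expansion of \<open>x\<close> from \<open>n\<close> on, and tails tend to 0.\<close>

lemma coef_tendsto_0: "coef x \<longlonglongrightarrow> 0"
proof (rule Lim_null_comparison)
  show "(\<lambda>n. qn (x - fin_comb {..<n} (coef x))) \<longlonglongrightarrow> 0"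
    using expands_coef[of x] by (simp add: expands_def fin_comb_def)
  have "norm (coef x n) \<le> qn (x - fin_comb {..<n} (coef x))" for n
    using norm_coef_le[of "x - fin_comb {..<n} (coef x)" n] by (simp add: coef_diff coef_fin_comb)
  then show "\<forall>\<^sub>F n in sequentially. norm (coef x n) \<le> qn (x - fin_comb {..<n} (coef x))"
    by simp
qed

section \<open>Democracy functions\<close>

lemma bdd_above_ind: "bdd_above ((\<lambda>\<Gamma>. qn (ind \<Gamma>)) ` {\<Gamma>. finite \<Gamma> \<and> card \<Gamma> = N})"
proof (rule bdd_aboveI2)
  fix \<Gamma> assume "\<Gamma> \<in> {\<Gamma> :: nat set. finite \<Gamma> \<and> card \<Gamma> = N}"
  then have "qn (ind \<Gamma>) powr \<rho> \<le> (real N powr (1/\<rho>)) powr \<rho>"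
    using qn_ind_powr_le_card[of \<Gamma>] rho_pos by (simp add: powr_powr)
  then show "qn (ind \<Gamma>) \<le> real N powr (1/\<rho>)" by (rule qn_powr_le_cancel) simp
qed

lemma sets_of_card_nonempty: "{\<Gamma> :: nat set. finite \<Gamma> \<and> card \<Gamma> = N} \<noteq> {}"
proof -
  have "{..<N} \<in> {\<Gamma>. finite \<Gamma> \<and> card \<Gamma> = N}" by simp
  then show ?thesis by blast
qed

lemma qn_ind_le_hr:
  assumes "finite \<Gamma>" "card \<Gamma> \<le> N"
  shows "qn (ind \<Gamma>) \<le> hr N"
proof -
  have "infinite (- \<Gamma>)" using assms(1) by (simp add: Compl_eq_Diff_UNIV)
  then obtain H where H: "finite H" "card H = N - card \<Gamma>" "H \<subseteq> - \<Gamma>"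
    using infinite_arbitrarily_large by metis
  define \<Gamma>' where "\<Gamma>' = \<Gamma> \<union> H"
  have "card \<Gamma>' = card \<Gamma> + card H"
    unfolding \<Gamma>'_def using H assms by (intro card_Un_disjoint) auto
  then have G: "\<Gamma> \<subseteq> \<Gamma>'" "finite \<Gamma>'" "card \<Gamma>' = N"
    using H assms by (auto simp: \<Gamma>'_def)
  have "qn (ind \<Gamma>) \<le> qn (ind \<Gamma>')" using G by (intro qn_ind_mono)
  also have "\<dots> \<le> hr N" unfolding h_right_def ind_def[symmetric]
    by (intro cSUP_upper bdd_above_ind) (use G in auto)
  finally show ?thesis .
qed

lemma hr_le:
  assumes "\<And>\<Gamma>. finite \<Gamma> \<Longrightarrow> card \<Gamma> = N \<Longrightarrow> qn (ind \<Gamma>) \<le> R"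
  shows "hr N \<le> R"
  unfolding h_right_def ind_def[symmetric]
  by (rule cSUP_least) (use sets_of_card_nonempty assms in auto)

lemma hl_le_qn_ind:
  assumes "finite \<Gamma>" "N \<le> card \<Gamma>"
  shows "hl N \<le> qn (ind \<Gamma>)"
proof -
  obtain \<Gamma>' where G: "\<Gamma>' \<subseteq> \<Gamma>" "finite \<Gamma>'" "card \<Gamma>' = N"
    using assms by (metis obtain_subset_with_card_n)
  have "hl N \<le> qn (ind \<Gamma>')" unfolding h_left_def ind_def[symmetric]
    by (intro cINF_lower bdd_belowI2[of _ 0]) (use G qn_nonneg in auto)
  also have "\<dots> \<le> qn (ind \<Gamma>)" using G assms by (intro qn_ind_mono)
  finally show ?thesis .
qed

lemma le_hl:
  assumes "\<And>\<Gamma>. finite \<Gamma> \<Longrightarrow> card \<Gamma> = N \<Longrightarrow> R \<le> qn (ind \<Gamma>)"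
  shows "R \<le> hl N"
  unfolding h_left_def ind_def[symmetric]
  by (rule cINF_greatest) (use sets_of_card_nonempty assms in auto)

lemma hl_ge_1: "1 \<le> N \<Longrightarrow> 1 \<le> hl N"
  by (rule le_hl, rule qn_ind_ge_1) auto

lemma hl_incr: "incr_weight hl"
  unfolding incr_weight_def by (auto intro!: le_hl hl_le_qn_ind)

lemma hr_nonneg: "0 \<le> hr N"
  using qn_ind_le_hr[of "{}" N] by (simp add: ind_def)

text \<open>A set of at most \<open>2k\<close> points splits into two sets of at most \<open>k\<close> points, so \<open>h\<^sub>r\<close> is always doubling.\<close>

lemma hr_slowly_growing: "slowly_growing (2 powr (1/\<rho>)) hr"
  unfolding slowly_growing_def
proof (intro allI impI conjI hr_nonneg)
  fix k l :: nat assume k: "1 \<le> k" and l: "k \<le> l \<and> l \<le> 2 * k"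
  show "hr l \<le> 2 powr (1/\<rho>) * hr k"
  proof (rule hr_le)
    fix \<Gamma> :: "nat set" assume G: "finite \<Gamma>" "card \<Gamma> = l"
    obtain \<Gamma>' where G': "\<Gamma>' \<subseteq> \<Gamma>" "finite \<Gamma>'" "card \<Gamma>' = k"
      using G l by (metis obtain_subset_with_card_n)
    have "qn (ind \<Gamma>') \<le> hr k" using G' by (intro qn_ind_le_hr) auto
    moreover have "qn (ind (\<Gamma> - \<Gamma>')) \<le> hr k"
      using G G' l by (intro qn_ind_le_hr) (auto simp: card_Diff_subset)
    ultimately have "qn (ind \<Gamma>') powr \<rho> + qn (ind (\<Gamma> - \<Gamma>')) powr \<rho> \<le> hr k powr \<rho> + hr k powr \<rho>"
      using rho_pos qn_nonneg by (intro add_mono powr_mono2) auto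
    then have "qn (ind \<Gamma>) powr \<rho> \<le> 2 * hr k powr \<rho>"
      using qn_ind_Un[OF G(1) G'(1)] by simp
    also have "\<dots> = (2 powr (1/\<rho>) * hr k) powr \<rho>" using rho_pos hr_nonneg by (simp add: powr_mult powr_powr)
    finally show "qn (ind \<Gamma>) \<le> 2 powr (1/\<rho>) * hr k"
      by (rule qn_powr_le_cancel) (use hr_nonneg in auto)
  qed
qed

text \<open>By the lattice property all coefficients may be raised to \<open>T\<close>.\<close>

lemma qn_fin_comb_le_hr:
  assumes "finite F" "card F \<le> N" "0 \<le> T" "\<And>j. j \<in> F \<Longrightarrow> norm (c j) \<le> T"
  shows "qn (fin_comb F c) \<le> T * hr N"
proof -
  have "qn (fin_comb F c) \<le> qn (fin_comb F (\<lambda>_. of_real T))"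
    using assms by (intro qn_fin_comb_mono) auto
  also have "fin_comb F (\<lambda>_. of_real T) = sc (of_real T) (ind F)"
    by (simp add: fin_comb_def ind_def scale_sum_right)
  also have "qn \<dots> = T * qn (ind F)" using assms by (simp add: qn_scale)
  also have "\<dots> \<le> T * hr N" using assms qn_ind_le_hr by (intro mult_left_mono) auto
  finally show ?thesis .
qed

lemma hl_le_qn:
  assumes "finite F" "N \<le> card F" "0 \<le> t" "\<And>j. j \<in> F \<Longrightarrow> t \<le> norm (coef x j)"
  shows "t * hl N \<le> qn x"
proof -
  have "t * hl N \<le> t * qn (ind F)" using assms hl_le_qn_ind by (intro mult_left_mono) auto
  also have "\<dots> = qn (sc (of_real t) (ind F))" using assms by (simp add: qn_scale)
  also have "sc (of_real t) (ind F) = fin_comb F (\<lambda>_. of_real t)"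
    by (simp add: fin_comb_def ind_def scale_sum_right)
  also have "qn \<dots> \<le> qn x" using assms by (intro qn_mono_coef) (auto simp: coef_fin_comb)
  finally show ?thesis .
qed

section \<open>Errors of approximation\<close>

lemma fin_comb_in_Sigma:
  assumes "finite F" "card F \<le> N"
  shows "fin_comb F c \<in> Sigma_N sc qn e N"
proof -
  have sub: "{j. (if j \<in> F then c j else 0) \<noteq> 0} \<subseteq> F" by auto
  then show ?thesis unfolding Sigma_N_def using assms card_mono[OF assms(1) sub]
    by (auto simp: coef_fin_comb intro: finite_subset[OF sub])
qed

lemma err_le_qn_diff: "finite F \<Longrightarrow> card F \<le> N \<Longrightarrow> err N x \<le> qn (x - fin_comb F c)"
  unfolding approx_error_def
  by (intro cINF_lower bdd_belowI2[of _ 0] fin_comb_in_Sigma) (auto simp: qn_nonneg)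

lemma le_err:
  assumes "\<And>y. y \<in> Sigma_N sc qn e N \<Longrightarrow> R \<le> qn (x - y)"
  shows "R \<le> err N x"
  unfolding approx_error_def
  using fin_comb_in_Sigma[of "{}" N "\<lambda>_. 0"] by (intro cINF_greatest) (use assms in auto)

lemma err_nonneg: "0 \<le> err N x"
  by (rule le_err) (rule qn_nonneg)

lemma err_le_qn: "err N x \<le> qn x"
  using err_le_qn_diff[of "{}" N x "\<lambda>_. 0"] by (simp add: fin_comb_def)

lemma err_antimono:
  assumes "N \<le> M" shows "err M x \<le> err N x"
  unfolding approx_error_def
  using fin_comb_in_Sigma[of "{}" N "\<lambda>_. 0"] assms
  by (intro cINF_superset_mono bdd_belowI2[of _ 0]) (auto simp: qn_nonneg Sigma_N_def)

lemma err_ind_eq_0: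
  assumes "finite \<Gamma>" "card \<Gamma> \<le> N" shows "err N (ind \<Gamma>) = 0"
  using err_le_qn_diff[OF assms, of "ind \<Gamma>" "\<lambda>_. 1"] err_nonneg[of N "ind \<Gamma>"]
  by (simp add: ind_eq_fin_comb)

text \<open>The coefficients of \<open>1\<^sub>\<Gamma>\<close> outside the support of an approximant survive in the difference. So an approximant with \<open>N\<close>
terms cannot do better than deleting \<open>N\<close> points of \<open>\<Gamma>\<close>.\<close>

lemma le_err_ind:
  assumes "finite \<Gamma>"
    and "\<And>\<Gamma>'. \<Gamma>' \<subseteq> \<Gamma> \<Longrightarrow> card (\<Gamma> - \<Gamma>') \<le> N \<Longrightarrow> R \<le> qn (ind \<Gamma>')"
  shows "R \<le> err N (ind \<Gamma>)"
proof (rule le_err)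
  fix y assume y: "y \<in> Sigma_N sc qn e N"
  define \<Gamma>' where "\<Gamma>' = \<Gamma> - {j. coef y j \<noteq> 0}"
  have "\<Gamma> - \<Gamma>' \<subseteq> {j. coef y j \<noteq> 0}" by (auto simp: \<Gamma>'_def)
  then have "card (\<Gamma> - \<Gamma>') \<le> N"
    using y card_mono[of "{j. coef y j \<noteq> 0}" "\<Gamma> - \<Gamma>'"] unfolding Sigma_N_def by auto
  then have "R \<le> qn (ind \<Gamma>')" by (intro assms) (auto simp: \<Gamma>'_def)
  also have "\<dots> \<le> qn (ind \<Gamma> - y)"
    using assms(1) by (intro qn_mono_coef) (auto simp: coef_diff coef_ind \<Gamma>'_def)
  finally show "R \<le> qn (ind \<Gamma> - y)" .
qed

text \<open>An approximant with \<open>N\<close> terms leaves untouched at least \<open>N\<close> of \<open>2N\<close> coefficients that exceed a level \<open>t < c\<^sup>*(2N)\<close>, so its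
distance from \<open>x\<close> is at least \<open>t h\<^sub>\<ell>(N)\<close>. Working with all \<open>t\<close> below \<open>c\<^sup>*(2N)\<close> avoids an ordering of the coefficients.\<close>

lemma decr_rearr_times_hl_le_err: "decr_rearr (coef x) (2 * N) * hl N \<le> err N x"
proof (cases "decr_rearr (coef x) (2 * N) \<le> 0 \<or> N = 0")
  case True
  then show ?thesis
  proof
    assume "decr_rearr (coef x) (2 * N) \<le> 0"
    moreover have "0 \<le> hl N" by (rule le_hl) (rule qn_nonneg)
    ultimately show ?thesis using err_nonneg by (meson mult_nonpos_nonneg order_trans)
  next
    assume "N = 0"
    have "hl 0 \<le> 0" using hl_le_qn_ind[of "{}" 0] by (simp add: ind_def)
    moreover have "0 \<le> hl 0" by (rule le_hl) (rule qn_nonneg)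
    ultimately show ?thesis using \<open>N = 0\<close> err_nonneg by simp
  qed
next
  case False
  then have N: "1 \<le> N" and pos: "0 < decr_rearr (coef x) (2 * N)" by auto
  have hl: "0 < hl N" using hl_ge_1[OF N] by linarith
  show ?thesis
  proof (rule le_err)
    fix y assume y: "y \<in> Sigma_N sc qn e N"
    let ?S = "{j. coef y j \<noteq> 0}"
    have S: "finite ?S" "card ?S \<le> N" using y by (auto simp: Sigma_N_def)
    have *: "t * hl N \<le> qn (x - y)" if t: "0 \<le> t" "t < decr_rearr (coef x) (2 * N)" for t
    proof -
      obtain F where F: "finite F" "card F = 2 * N" "\<And>j. j \<in> F \<Longrightarrow> t < norm (coef x j)"
        using subset_above_if_less_decr_rearr[OF t] by auto
      have "N \<le> card (F - ?S)" using F S diff_card_le_card_Diff[of ?S F] by linarith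
      then show ?thesis using F t
        by (intro hl_le_qn[of "F - ?S"]) (auto simp: coef_diff less_imp_le)
    qed
    show "decr_rearr (coef x) (2 * N) * hl N \<le> qn (x - y)"
    proof (rule ccontr)
      assume "\<not> ?thesis"
      then have "qn (x - y) / hl N < decr_rearr (coef x) (2 * N)" using hl by (simp add: field_simps)
      then obtain t where t: "qn (x - y) / hl N < t" "t < decr_rearr (coef x) (2 * N)"
        using dense by blast
      moreover have "0 \<le> qn (x - y) / hl N" using qn_nonneg hl by simp
      ultimately have "t * hl N \<le> qn (x - y)" by (intro *) auto
      then show False using t hl by (simp add: field_simps)
    qed
  qed
qed

abbreviation "dr x \<equiv> decr_rearr (coef x)"

lemma dr_nonneg: "1 \<le> k \<Longrightarrow> 0 \<le> dr x k"
  by (rule decr_rearr_nonneg[of "coef x" "qn x"]) (rule norm_coef_le)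

lemma dr_slowly_growing: "slowly_growing 1 (dr x)"
  by (rule slowly_growing_if_decreasing)
    (use decr_rearr_antimono[of "coef x" "qn x"] norm_coef_le dr_nonneg in auto)

lemma err_slowly_growing:
  assumes "0 < \<alpha>" shows "slowly_growing (2 powr \<alpha>) (\<lambda>N. real N powr \<alpha> * err N x)"
  using slowly_growing_mult[OF slowly_growing_powr[of \<alpha>] slowly_growing_if_decreasing[of "\<lambda>N. err N x"]] assms
  by (simp add: err_nonneg err_antimono)

lemma approx_normI:
  assumes "0 \<le> R" "0 \<le> S" "qn x \<le> R" "lq_bracket q (\<lambda>N. real N powr \<alpha> * err N x) \<le> ennreal S"
  shows "approx_norm sc qn e \<alpha> q x \<le> ennreal (R + S)"
  unfolding approx_norm_def using assms by (auto simp: ennreal_leI intro!: add_mono)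

lemma approx_normD:
  assumes "approx_norm sc qn e \<alpha> q x \<le> ennreal R" "0 \<le> R"
  shows "qn x \<le> R" "lq_bracket q (\<lambda>N. real N powr \<alpha> * err N x) \<le> ennreal R"
proof -
  have "ennreal (qn x) \<le> approx_norm sc qn e \<alpha> q x"
    unfolding approx_norm_def by simp
  then have "ennreal (qn x) \<le> ennreal R" using assms(1) by (rule order_trans)
  then show "qn x \<le> R" using assms(2) by (simp add: ennreal_le_iff)
  have "lq_bracket q (\<lambda>N. real N powr \<alpha> * err N x) \<le> approx_norm sc qn e \<alpha> q x"
    unfolding approx_norm_def by simp
  then show "lq_bracket q (\<lambda>N. real N powr \<alpha> * err N x) \<le> ennreal R" using assms(1) by (rule order_trans)
qed

section \<open>Embedding of the Lorentz space into the approximation space\<close>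

text \<open>The set \<open>F\<close> consists of the indices whose coefficients exceed \<open>c\<^sup>*(2\<^sup>m)\<close>, so that \<open>x - fin_comb F (coef x)\<close> is the remainder of a
greedy approximation. The remaining coefficients are grouped by the levels \<open>c\<^sup>*(2\<^sup>j)\<close> with \<open>j \<ge> m\<close>. The bound is first proved
for finite parts of the remainder, uniformly, and then for the remainder as the limit of its partial sums.\<close>

lemma greedy_remainder_powr_le:
  assumes le: "\<And>n. (\<Sum>j<n. (decr_rearr (coef x) (2 ^ (m + j)) * hr (2 ^ (m + j + 1))) powr \<rho>) \<le> Z"
  shows "\<exists>F. finite F \<and> card F < 2 ^ m \<and> qn (x - fin_comb F (coef x)) powr \<rho> \<le> Z"
proof -
  define c where "c = coef x"
  define T where "T j = decr_rearr c (2 ^ j)" for j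
  define A where "A j = {i. T j < norm (c i)}" for j
  have B: "\<And>j. norm (c j) \<le> qn x" by (simp add: c_def norm_coef_le)
  have T0: "0 \<le> T j" for j unfolding T_def by (rule decr_rearr_nonneg[of c, OF B]) simp
  have A: "finite (A j)" "card (A j) < 2 ^ j" for j
    using card_gt_decr_rearr[of c, OF B, of "2^j"] by (auto simp: A_def T_def)
  have T_mono: "T k \<le> T j" if "j \<le> k" for j k
    unfolding T_def using that by (intro decr_rearr_antimono[of c, OF B]) auto
  have A_mono: "A j \<subseteq> A k" if "j \<le> k" for j k using T_mono[OF that] by (auto simp: A_def)
  have block: "qn (fin_comb F c) powr \<rho> \<le> (\<Sum>j<k. (T (m + j) * hr (2 ^ (m + j + 1))) powr \<rho>)"
    if "F \<subseteq> A (m + k)" "F \<inter> A m = {}" for F k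
    using that
  proof (induction k arbitrary: F)
    case 0
    then have "F = {}" by auto
    then show ?case by (simp add: fin_comb_def)
  next
    case (Suc k)
    have fF: "finite F" using Suc.prems A(1) finite_subset by blast
    let ?G = "F \<inter> A (m + k)"
    have split: "fin_comb F c = fin_comb ?G c + fin_comb (F - A (m + k)) c"
      unfolding fin_comb_def by (rule sum.Int_Diff[OF fF])
    have "qn (fin_comb (F - A (m + k)) c) \<le> T (m + k) * hr (2 ^ (m + k + 1))"
    proof (rule qn_fin_comb_le_hr)
      have "card (F - A (m + k)) \<le> card (A (m + Suc k))"
        using Suc.prems by (intro card_mono A) auto
      also have "\<dots> \<le> 2 ^ (m + k + 1)" using A(2)[of "m + Suc k"] by simp
      finally show "card (F - A (m + k)) \<le> 2 ^ (m + k + 1)" .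
      show "norm (c j) \<le> T (m + k)" if "j \<in> F - A (m + k)" for j using that by (auto simp: A_def)
    qed (use fF T0 in auto)
    then have "qn (fin_comb (F - A (m + k)) c) powr \<rho> \<le> (T (m + k) * hr (2 ^ (m + k + 1))) powr \<rho>"
      using rho_pos qn_nonneg by (intro powr_mono2) auto
    moreover have "qn (fin_comb ?G c) powr \<rho> \<le> (\<Sum>j<k. (T (m + j) * hr (2 ^ (m + j + 1))) powr \<rho>)"
      using Suc.prems by (intro Suc.IH) auto
    ultimately show ?case
      using qn_triangle[of "fin_comb ?G c" "fin_comb (F - A (m + k)) c"] unfolding split by simp
  qed
  \<comment> \<open>The levels tend to 0, so each index with nonzero coefficient is eventually above a level.\<close>
  have reach: "\<exists>k. i \<in> A (m + k)" if "c i \<noteq> 0" for i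
  proof -
    have "eventually (\<lambda>j. norm (c j) < norm (c i) / 2) sequentially"
      using tendsto_norm_zero[OF coef_tendsto_0[of x]]
      unfolding c_def by (rule order_tendstoD) (use that in \<open>simp add: c_def\<close>)
    then obtain M where M: "\<And>j. M \<le> j \<Longrightarrow> norm (c j) < norm (c i) / 2"
      unfolding eventually_sequentially by blast
    have sub: "{j. norm (c i) / 2 < norm (c j)} \<subseteq> {..<M}" 
    proof (intro subsetI, unfold mem_Collect_eq)
      fix j assume "norm (c i) / 2 < norm (c j)"
      then show "j \<in> {..<M}" using M[of j] by (cases "M \<le> j") auto
    qed
    then have fin: "finite {j. norm (c i) / 2 < norm (c j)}" by (rule finite_subset) simp
    have "card {j. norm (c i) / 2 < norm (c j)} \<le> M" using card_mono[OF _ sub] by simp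
    also have "M < 2 ^ (m + M)" by (meson le_add2 less_exp less_le_trans one_le_numeral power_increasing)
    finally have "T (m + M) \<le> norm (c i) / 2"
      unfolding T_def using fin by (intro decr_rearr_le) auto
    moreover have "0 < norm (c i)" using that by simp
    ultimately have "T (m + M) < norm (c i)" by linarith
    then show ?thesis by (intro exI[of _ M]) (simp add: A_def)
  qed
  have fin_le: "qn (fin_comb F c) powr \<rho> \<le> Z" if F: "finite F" "F \<inter> A m = {}" for F
  proof -
    let ?F = "{i \<in> F. c i \<noteq> 0}"
    have "\<exists>k. ?F \<subseteq> A (m + k)"
    proof -
      obtain \<kappa> where \<kappa>: "\<And>i. c i \<noteq> 0 \<Longrightarrow> i \<in> A (m + \<kappa> i)" using reach by metis
      have "i \<in> A (m + Max (\<kappa> ` F))" if "i \<in> ?F" for i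
        using \<kappa>[of i] that A_mono[of "m + \<kappa> i" "m + Max (\<kappa> ` F)"] F(1) by auto
      then show ?thesis by blast
    qed
    then obtain k where k: "?F \<subseteq> A (m + k)" by blast
    have "fin_comb F c = fin_comb ?F c"
      unfolding fin_comb_def using F by (intro sum.mono_neutral_right) auto
    moreover have "?F \<inter> A m = {}" using F(2) by blast
    ultimately show ?thesis using block[OF k] le[of k] unfolding T_def c_def by auto
  qed
  define y where "y = x - fin_comb (A m) c"
  have "qn y powr \<rho> \<le> Z"
  proof (rule LIMSEQ_le_const)
    have y: "expands sc qn e (coef y) y" by (rule expands_coef)
    have cy: "coef y = (\<lambda>j. if j \<in> A m then 0 else c j)"
      using A by (auto simp: y_def coef_diff coef_fin_comb c_def)
    have "(\<Sum>j<n. sc (coef y j) (e j)) = fin_comb ({..<n} - A m) c" for n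
      unfolding fin_comb_def cy by (intro sum.mono_neutral_cong_right) auto
    then have "(\<lambda>n. qn (y - fin_comb ({..<n} - A m) c)) \<longlonglongrightarrow> 0" using y by (simp add: expands_def)
    then have "(\<lambda>n. qn (y - fin_comb ({..<n} - A m) c) powr \<rho> + Z) \<longlonglongrightarrow> 0 + Z"
      by (intro tendsto_add tendsto_qn_powr tendsto_const)
    then show "(\<lambda>n. qn (y - fin_comb ({..<n} - A m) c) powr \<rho> + Z) \<longlonglongrightarrow> Z" by simp
    have "qn y powr \<rho> \<le> qn (y - fin_comb ({..<n} - A m) c) powr \<rho> + Z" for n
    proof -
      have "({..<n} - A m) \<inter> A m = {}" by blast
      then show ?thesis
        using qn_triangle[of "y - fin_comb ({..<n} - A m) c" "fin_comb ({..<n} - A m) c"]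
          fin_le[of "{..<n} - A m"] by simp
    qed
    then show "\<exists>N. \<forall>n\<ge>N. qn y powr \<rho> \<le> qn (y - fin_comb ({..<n} - A m) c) powr \<rho> + Z" by blast
  qed
  then show ?thesis using A[of m] unfolding y_def c_def by blast
qed

text \<open>The bound \<open>T\<close> says that the products \<open>h\<^sub>r(2\<^sup>j) c\<^sup>*(2\<^sup>j)\<close> with \<open>j = m + i\<close> are at most \<open>2\<^sup>-\<^sup>m\<^sup>\<alpha> T\<close> times \<open>2\<^sup>-\<^sup>i\<^sup>\<alpha>\<^sup>/\<^sup>2\<close>. Half of
the exponent \<open>\<alpha>\<close> is spent here to sum the \<open>\<rho>\<close>-th powers, and half is kept for the Hardy inequality.\<close>

lemma greedy_remainder_le_if_tail_le:
  assumes \<alpha>: "0 < \<alpha>"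
  obtains K where "0 < K" "\<And>x m T.
    (\<And>i. 2 powr (- (\<alpha>/2) * real i) * (2 powr (\<alpha> * real (m + i)) * hr (2 ^ (m + i)) * dr x (2 ^ (m + i))) \<le> T) \<Longrightarrow>
    \<exists>F. finite F \<and> card F < 2 ^ m \<and> 2 powr (\<alpha> * real m) * qn (x - fin_comb F (coef x)) \<le> K * T"
proof -
  define r :: real where "r = 2 powr (- (\<alpha>/2) * \<rho>)"
  have r: "0 < r" "r < 1" using \<alpha> rho_pos by (auto simp: r_def powr_less_one)
  define D :: real where "D = 2 powr (1/\<rho>)"
  define K where "K = D * (1 / (1 - r)) powr (1/\<rho>)"
  show thesis
  proof (rule that[of K])
    show "0 < K" using r by (simp add: K_def D_def)
    fix x m T
    assume T: "\<And>i. 2 powr (- (\<alpha>/2) * real i) * (2 powr (\<alpha> * real (m + i)) * hr (2 ^ (m + i)) * dr x (2 ^ (m + i))) \<le> T"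
    have T0: "0 \<le> T"
      using T[of 0] hr_nonneg[of "2^m"] dr_nonneg[of "2^m" x]
      by (smt (verit) add_0_right mult_nonneg_nonneg one_le_numeral one_le_power powr_ge_zero)
    define U where "U = T * 2 powr (- \<alpha> * real m)"
    have U0: "0 \<le> U" using T0 by (simp add: U_def)
    have tail_term: "dr x (2 ^ (m + i)) * hr (2 ^ (m + i + 1)) \<le> D * U * 2 powr (- (\<alpha>/2) * real i)" for i
    proof -
      have d0: "0 \<le> dr x (2 ^ (m + i))" by (rule dr_nonneg) simp
      have "hr (2 ^ (m + i + 1)) \<le> D * hr (2 ^ (m + i))"
        using hr_slowly_growing unfolding slowly_growing_def D_def by simp
      then have "dr x (2 ^ (m + i)) * hr (2 ^ (m + i + 1)) \<le> dr x (2 ^ (m + i)) * (D * hr (2 ^ (m + i)))"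
        using d0 by (rule mult_left_mono)
      also have "\<dots> = D * (2 powr (- (\<alpha>/2) * real i) * (2 powr (\<alpha> * real (m + i)) * hr (2 ^ (m + i)) * dr x (2 ^ (m + i))))
          * (2 powr (- \<alpha> * real m) * 2 powr (- (\<alpha>/2) * real i))"
      proof -
        have "2 powr (- (\<alpha>/2) * real i) * 2 powr (\<alpha> * real (m + i)) * (2 powr (- \<alpha> * real m) * 2 powr (- (\<alpha>/2) * real i)) = (1::real)"
          by (simp add: powr_add[symmetric] algebra_simps)
        then show ?thesis by (simp add: mult_ac)
      qed
      also have "\<dots> \<le> D * T * (2 powr (- \<alpha> * real m) * 2 powr (- (\<alpha>/2) * real i))"
        using T[of i] by (intro mult_right_mono mult_left_mono) (auto simp: D_def)
      finally show ?thesis by (simp add: U_def mult_ac)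
    qed
    have "\<exists>F. finite F \<and> card F < 2 ^ m \<and> qn (x - fin_comb F (coef x)) powr \<rho> \<le> (K * U) powr \<rho>"
    proof (rule greedy_remainder_powr_le)
      fix n
      have "(\<Sum>j<n. (dr x (2 ^ (m + j)) * hr (2 ^ (m + j + 1))) powr \<rho>)
          \<le> (\<Sum>j<n. (D * U) powr \<rho> * r ^ j)"
      proof (rule sum_mono)
        fix j
        have "(dr x (2 ^ (m + j)) * hr (2 ^ (m + j + 1))) powr \<rho> \<le> (D * U * 2 powr (- (\<alpha>/2) * real j)) powr \<rho>"
          using tail_term[of j] rho_pos dr_nonneg[of "2^(m+j)" x] hr_nonneg by (intro powr_mono2) auto
        also have "\<dots> = (D * U) powr \<rho> * r ^ j"
          using U0 by (simp add: powr_mult D_def r_def powr_powr powr_power algebra_simps)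
        finally show "(dr x (2 ^ (m + j)) * hr (2 ^ (m + j + 1))) powr \<rho> \<le> (D * U) powr \<rho> * r ^ j" .
      qed
      also have "\<dots> = (D * U) powr \<rho> * (\<Sum>j<n. r ^ j)" by (simp add: sum_distrib_left)
      also have "(\<Sum>j<n. r ^ j) \<le> 1 / (1 - r)"
        using sum_le_suminf[OF summable_geometric[of r], of "{..<n}"] r by (simp add: suminf_geometric)
      also have "(D * U) powr \<rho> * (1 / (1 - r)) = (K * U) powr \<rho>"
        using r U0 rho_pos by (simp add: K_def powr_mult powr_powr D_def)
      finally show "(\<Sum>j<n. (dr x (2 ^ (m + j)) * hr (2 ^ (m + j + 1))) powr \<rho>) \<le> (K * U) powr \<rho>"
        by (simp add: mult_left_mono)
    qed
    then obtain F where F: "finite F" "card F < 2 ^ m"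
      "qn (x - fin_comb F (coef x)) powr \<rho> \<le> (K * U) powr \<rho>" by blast
    have "0 \<le> K * U" using U0 \<open>0 < K\<close> by simp
    then have "qn (x - fin_comb F (coef x)) \<le> K * U" using F(3) by (intro qn_powr_le_cancel)
    then have "2 powr (\<alpha> * real m) * qn (x - fin_comb F (coef x)) \<le> 2 powr (\<alpha> * real m) * (K * U)"
      by (intro mult_left_mono) auto
    also have "\<dots> = K * T * (2 powr (\<alpha> * real m) * 2 powr (- \<alpha> * real m))" by (simp add: U_def mult_ac)
    also have "\<dots> = K * T" by (simp add: powr_add[symmetric])
    finally show "\<exists>F. finite F \<and> card F < 2 ^ m \<and> 2 powr (\<alpha> * real m) * qn (x - fin_comb F (coef x)) \<le> K * T"
      using F by blast
  qed
qed

lemma real_2_power_powr: "real (2 ^ j) powr \<alpha> = 2 powr (\<alpha> * real j)"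
  by (simp add: powr_realpow[symmetric] powr_powr mult.commute)

text \<open>The Hardy inequality is applied to the dyadic samples of \<open>k\<^sup>\<alpha> h\<^sub>r(k) c\<^sup>*(k)\<close> on the one side and of \<open>N\<^sup>\<alpha> \<sigma>\<^sub>N\<close> on the other.
The bound on \<open>\<parallel>x\<parallel>\<close> itself is the case \<open>m = 0\<close> of the estimate for greedy remainders, where nothing is removed from \<open>x\<close>.\<close>

lemma lorentz_hr_embeds_approx:
  assumes \<alpha>: "0 < \<alpha>" and q: "0 < q"
  shows "embeds (lorentz_norm sc qn e q (\<lambda>k. real k powr \<alpha> * hr k)) (approx_norm sc qn e \<alpha> q)"
proof -
  obtain K where K: "0 < K" "\<And>x m T.
    (\<And>i. 2 powr (- (\<alpha>/2) * real i) * (2 powr (\<alpha> * real (m + i)) * hr (2 ^ (m + i)) * dr x (2 ^ (m + i))) \<le> T) \<Longrightarrow>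
    \<exists>F. finite F \<and> card F < 2 ^ m \<and> 2 powr (\<alpha> * real m) * qn (x - fin_comb F (coef x)) \<le> K * T"
    using greedy_remainder_le_if_tail_le[OF \<alpha>] by metis
  define D where "D = 2 powr \<alpha> * 2 powr (1/\<rho>)"
  have D1: "1 \<le> D" using \<alpha> rho_pos by (simp add: D_def powr_add[symmetric] ge_one_powr_ge_zero)
  have sl: "slowly_growing D (\<lambda>k. real k powr \<alpha> * hr k * dr x k)" for x
    unfolding D_def using slowly_growing_mult[OF slowly_growing_mult[OF slowly_growing_powr hr_slowly_growing] dr_slowly_growing, of \<alpha> x] \<alpha> by simp
  obtain C1 where C1: "0 < C1"
    "\<And>a R. slowly_growing D a \<Longrightarrow> 0 \<le> R \<Longrightarrow> lq_bracket q a \<le> ennreal R \<Longrightarrow> lq_le q (\<lambda>j. a (2 ^ j)) (C1 * R)"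
    using dyadic_le_if_lq_bracket[OF q D1] by metis
  obtain C2 where C2: "0 < C2"
    "\<And>b v R. (\<And>j. 0 \<le> b j) \<Longrightarrow> 0 \<le> R \<Longrightarrow> lq_le q b R \<Longrightarrow> (\<And>m. 0 \<le> v m) \<Longrightarrow>
       (\<And>m T. (\<And>i. 2 powr (- (\<alpha>/2) * real i) * b (m + i) \<le> T) \<Longrightarrow> v m \<le> T) \<Longrightarrow> lq_le q v (C2 * R)"
    using lq_le_geometric_average[OF q, of "\<alpha>/2"] \<alpha> by (metis half_gt_zero)
  show ?thesis
  proof (rule embedsI)
    show "0 < K * C1 + 2 powr \<alpha> * (K * (C2 * C1))" using K C1 C2 by (intro add_pos_pos) auto
    fix x and R :: real
    assume R: "0 \<le> R" and le: "lorentz_norm sc qn e q (\<lambda>k. real k powr \<alpha> * hr k) x \<le> ennreal R"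
    define b where "b j = 2 powr (\<alpha> * real j) * hr (2 ^ j) * dr x (2 ^ j)" for j
    have b0: "0 \<le> b j" for j using hr_nonneg dr_nonneg[of "2^j" x] by (simp add: b_def)
    have b: "lq_le q b (C1 * R)"
      using C1(2)[OF sl R le[unfolded lorentz_norm_def]] by (simp only: b_def[abs_def] real_2_power_powr)
    have C1R: "0 \<le> C1 * R" using C1 R by simp
    define v where "v m = 2 powr (\<alpha> * real m) * err (2 ^ m) x" for m
    have v0: "0 \<le> v m" for m using err_nonneg by (simp add: v_def)
    have "lq_le q (\<lambda>m. v m / K) (C2 * (C1 * R))"
    proof (rule C2(2)[OF b0 C1R b])
      show "0 \<le> v m / K" for m using v0 K by simp
      fix m T assume "\<And>i. 2 powr (- (\<alpha>/2) * real i) * b (m + i) \<le> T"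
      then obtain F where F: "finite F" "card F < 2 ^ m"
        "2 powr (\<alpha> * real m) * qn (x - fin_comb F (coef x)) \<le> K * T"
        using K(2)[of m x T] unfolding b_def by blast
      have "v m \<le> 2 powr (\<alpha> * real m) * qn (x - fin_comb F (coef x))"
        unfolding v_def using F by (intro mult_left_mono err_le_qn_diff) auto
      then show "v m / K \<le> T" using F K by (simp add: field_simps)
    qed
    then have "lq_le q (\<lambda>m. K * (v m / K)) (K * (C2 * (C1 * R)))"
      using K C2 C1R v0 by (intro lq_le_scale[OF q]) auto
    then have "lq_le q (\<lambda>m. real (2 ^ m) powr \<alpha> * err (2 ^ m) x) (K * (C2 * (C1 * R)))"
      using K by (simp only: v_def real_2_power_powr) simp
    then have br: "lq_bracket q (\<lambda>N. real N powr \<alpha> * err N x) \<le> ennreal (2 powr \<alpha> * (K * (C2 * (C1 * R))))"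
      using K C2 C1R by (intro lq_bracket_le_if_dyadic[OF q _ _ err_slowly_growing[OF \<alpha>]]) auto
    have "\<exists>F. finite F \<and> card F < 2 ^ 0 \<and> 2 powr (\<alpha> * real 0) * qn (x - fin_comb F (coef x)) \<le> K * (C1 * R)"
    proof (rule K(2))
      fix i
      have "2 powr (- (\<alpha>/2) * real i) \<le> 2 powr 0" using \<alpha> by (intro powr_mono) auto
      then have "2 powr (- (\<alpha>/2) * real i) * b (0 + i) \<le> 1 * b i"
        using b0 by (simp only: add_0, intro mult_right_mono) auto
      also have "\<dots> \<le> C1 * R" using lq_le_pointwise[OF q C1R b0 b] by simp
      finally show "2 powr (- (\<alpha>/2) * real i) * (2 powr (\<alpha> * real (0 + i)) * hr (2 ^ (0 + i)) * dr x (2 ^ (0 + i))) \<le> C1 * R"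
        unfolding b_def .
    qed
    then have "qn x \<le> K * (C1 * R)" by (auto simp: fin_comb_def)
    then have "approx_norm sc qn e \<alpha> q x \<le> ennreal (K * (C1 * R) + 2 powr \<alpha> * (K * (C2 * (C1 * R))))"
      using br K C2 C1R by (intro approx_normI) auto
    then show "approx_norm sc qn e \<alpha> q x \<le> ennreal ((K * C1 + 2 powr \<alpha> * (K * (C2 * C1))) * R)"
      by (simp add: algebra_simps)
  qed
qed

section \<open>Embedding of the approximation space into the Lorentz space\<close>

lemma dr_1_le: "dr x 1 \<le> qn x"
proof -
  have "{j. qn x < norm (coef x j)} = {}" using norm_coef_le[of x] by (auto simp: not_less)
  then show ?thesis by (intro decr_rearr_le) (auto simp: qn_nonneg)
qed

text \<open>The dyadic sample of the Lorentz sequence at \<open>2\<^sup>j\<^sup>+\<^sup>1\<close> is compared with that of \<open>N\<^sup>\<alpha> \<sigma>\<^sub>N\<close> at \<open>2\<^sup>j\<close>. The first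
sample, at index 1, has no counterpart; it is controlled by the summand \<open>\<parallel>x\<parallel>\<close> of the approximation norm.\<close>

lemma approx_embeds_lorentz_hl:
  assumes \<alpha>: "0 < \<alpha>" and q: "0 < q" and dbl: "doubling hl"
  shows "embeds (approx_norm sc qn e \<alpha> q) (lorentz_norm sc qn e q (\<lambda>k. real k powr \<alpha> * hl k))"
proof -
  have hl0: "0 \<le> hl k" for k by (rule le_hl) (rule qn_nonneg)
  obtain E where E: "1 \<le> E" "slowly_growing E hl"
    using slowly_growing_if_doubling[OF hl_incr dbl] hl0 by blast
  define D where "D = 2 powr \<alpha> * E"
  have a1: "1 \<le> 2 powr \<alpha>" using \<alpha> by (simp add: ge_one_powr_ge_zero)
  then have D1: "1 \<le> D" using E mult_mono[of 1 "2 powr \<alpha>" 1 E] by (simp add: D_def)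
  have sl: "slowly_growing D (\<lambda>k. real k powr \<alpha> * hl k * dr x k)" for x
    unfolding D_def using slowly_growing_mult[OF slowly_growing_mult[OF slowly_growing_powr E(2)] dr_slowly_growing, of \<alpha> x] \<alpha> E by simp
  obtain C1 where C1: "0 < C1"
    "\<And>a R. slowly_growing (2 powr \<alpha>) a \<Longrightarrow> 0 \<le> R \<Longrightarrow> lq_bracket q a \<le> ennreal R \<Longrightarrow> lq_le q (\<lambda>j. a (2 ^ j)) (C1 * R)"
    using dyadic_le_if_lq_bracket[OF q a1] by metis
  \<comment> \<open>The first entry takes care of the sample at index 1, the second one of all later samples.\<close>
  define C where "C = max (hl 1) (D * C1)"
  have Cp: "0 < C" using C1 D1 by (simp add: C_def less_max_iff_disj)
  define P where "P = 2 powr (1 / enn2real q)"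
  show ?thesis
  proof (rule embedsI)
    show "0 < D * (P * C)" using D1 Cp by (simp add: P_def)
    fix x and R :: real
    assume R: "0 \<le> R" and le: "approx_norm sc qn e \<alpha> q x \<le> ennreal R"
    define u where "u j = real (2 ^ j) powr \<alpha> * hl (2 ^ j) * dr x (2 ^ j)" for j
    have u0: "0 \<le> u j" for j using hl0 dr_nonneg[of "2^j" x] by (simp add: u_def)
    have CR: "0 \<le> C * R" using Cp R by simp
    have "lq_le q (\<lambda>j. real (2 ^ j) powr \<alpha> * err (2 ^ j) x) (C1 * R)"
      by (rule C1(2)[OF err_slowly_growing[OF \<alpha>] R approx_normD(2)[OF le R]])
    then have "lq_le q (\<lambda>j. D * (real (2 ^ j) powr \<alpha> * err (2 ^ j) x)) (D * (C1 * R))"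
      using D1 C1 R err_nonneg by (intro lq_le_scale[OF q]) auto
    then have "lq_le q (\<lambda>j. u (Suc j)) (D * (C1 * R))"
    proof (rule lq_le_cong_le[OF q u0, rotated])
      fix j
      have "u (Suc j) = real (2 ^ Suc j) powr \<alpha> * dr x (2 * 2 ^ j) * hl (2 ^ Suc j)" by (simp add: u_def)
      also have "real (2 ^ Suc j) powr \<alpha> = 2 powr \<alpha> * real (2 ^ j) powr \<alpha>" by (simp add: powr_mult)
      also have "2 powr \<alpha> * real (2 ^ j) powr \<alpha> * dr x (2 * 2 ^ j) * hl (2 ^ Suc j)
        \<le> 2 powr \<alpha> * real (2 ^ j) powr \<alpha> * dr x (2 * 2 ^ j) * (E * hl (2 ^ j))"
        using E(2) dr_nonneg[of "2 * 2^j" x] unfolding slowly_growing_def by (intro mult_left_mono) auto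
      also have "\<dots> = D * real (2 ^ j) powr \<alpha> * (dr x (2 * 2 ^ j) * hl (2 ^ j))" by (simp add: D_def)
      also have "\<dots> \<le> D * real (2 ^ j) powr \<alpha> * err (2 ^ j) x"
        using D1 by (intro mult_left_mono decr_rearr_times_hl_le_err) auto
      finally show "u (Suc j) \<le> D * (real (2 ^ j) powr \<alpha> * err (2 ^ j) x)" by (simp add: mult.assoc)
    qed
    moreover have "D * (C1 * R) \<le> C * R"
      using R by (simp add: C_def mult.assoc[symmetric] mult_right_mono)
    ultimately have "lq_le q (\<lambda>j. u (Suc j)) (C * R)"
      using C1(1) D1 R by (elim lq_le_mono_bound[OF q]) auto
    moreover have "u 0 \<le> C * R"
    proof -
      have "u 0 = hl 1 * dr x 1" by (simp add: u_def)
      also have "\<dots> \<le> C * R"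
        using dr_1_le[of x] approx_normD(1)[OF le R] hl0 dr_nonneg[of 1 x] Cp
        by (intro mult_mono) (auto simp: C_def)
      finally show ?thesis .
    qed
    ultimately have "lq_le q u (P * (C * R))"
      unfolding P_def using CR u0 by (intro lq_le_cons[OF q]) auto
    then have "lq_bracket q (\<lambda>k. real k powr \<alpha> * hl k * dr x k) \<le> ennreal (D * (P * (C * R)))"
      using D1 CR by (intro lq_bracket_le_if_dyadic[OF q _ _ sl]) (auto simp: u_def[abs_def] P_def)
    then show "lorentz_norm sc qn e q (\<lambda>k. real k powr \<alpha> * hl k) x \<le> ennreal (D * (P * C) * R)"
      by (simp add: lorentz_norm_def mult.assoc)
  qed
qed

section \<open>Optimality of the lower embedding\<close>

lemma dr_ind: "finite \<Gamma> \<Longrightarrow> 1 \<le> k \<Longrightarrow> dr (ind \<Gamma>) k = (if k \<le> card \<Gamma> then 1 else 0)"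
  by (simp add: coef_ind decr_rearr_indicator)

text \<open>Since \<open>\<omega>(2\<^sup>j)\<close> grows geometrically, the norm of a rearrangement that is 1 up to \<open>|\<Gamma>|\<close> and 0 afterwards is controlled by the last
sample.\<close>

lemma lorentz_ind_le:
  assumes q: "0 < q" and w: "\<omega> \<in> weights_plus"
  obtains C where "0 < C"
    "\<And>J \<Gamma>. finite \<Gamma> \<Longrightarrow> card \<Gamma> \<le> 2 ^ J \<Longrightarrow> lorentz_norm sc qn e q \<omega> (ind \<Gamma>) \<le> ennreal (C * \<omega> (2 ^ J))"
proof -
  have w': "\<omega> \<in> weights" and "\<exists>\<kappa>>1. dil \<omega> \<kappa> < 1" using w by (auto simp: weights_plus_def)
  then obtain \<kappa> where \<kappa>: "1 < \<kappa>" "dil \<omega> \<kappa> < 1" by blast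
  note W = weightsD[OF w']
  obtain D where D: "1 \<le> D" "slowly_growing D \<omega>"
    using slowly_growing_if_doubling[OF W(2,3)] W(1) by (metis less_imp_le)
  obtain A \<epsilon> where A: "0 < A" "0 < \<epsilon>"
    "\<And>j J. j \<le> J \<Longrightarrow> \<omega> (2 ^ j) \<le> A * 2 powr (- \<epsilon> * real (J - j)) * \<omega> (2 ^ J)"
    using dyadic_growth_if_dil_less_1[OF W(1,2) \<kappa>] by metis
  obtain G where G: "0 < G"
    "\<And>v J R. 0 \<le> R \<Longrightarrow> (\<And>j. 0 \<le> v j) \<Longrightarrow> (\<And>j. j \<le> J \<Longrightarrow> v j \<le> 2 powr (- \<epsilon> * real (J - j)) * R) \<Longrightarrow>
       (\<And>j. J < j \<Longrightarrow> v j = 0) \<Longrightarrow> lq_le q v (G * R)"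
    using lq_le_geometric_tail[OF q A(2)] by metis
  show thesis
  proof (rule that)
    show "0 < D * (G * A)" using D G A by simp
    fix J :: nat and \<Gamma> :: "nat set" assume Gam: "finite \<Gamma>" "card \<Gamma> \<le> 2 ^ J"
    have wJ: "0 < \<omega> (2 ^ J)" by (rule W(1)) simp
    have "lq_le q (\<lambda>j. \<omega> (2 ^ j) * dr (ind \<Gamma>) (2 ^ j)) (G * (A * \<omega> (2 ^ J)))"
    proof (rule G(2))
      show "0 \<le> A * \<omega> (2 ^ J)" using A wJ by simp
      show "0 \<le> \<omega> (2 ^ j) * dr (ind \<Gamma>) (2 ^ j)" for j
        using W(1)[of "2^j"] Gam by (simp add: dr_ind)
      show "\<omega> (2 ^ j) * dr (ind \<Gamma>) (2 ^ j) = 0" if "J < j" for j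
      proof -
        have "(2::nat) ^ J < 2 ^ j" using that by simp
        then have "\<not> 2 ^ j \<le> card \<Gamma>" using Gam by linarith
        then show ?thesis using Gam by (simp add: dr_ind)
      qed
      show "\<omega> (2 ^ j) * dr (ind \<Gamma>) (2 ^ j) \<le> 2 powr (- \<epsilon> * real (J - j)) * (A * \<omega> (2 ^ J))" if "j \<le> J" for j
      proof -
        have "\<omega> (2 ^ j) * dr (ind \<Gamma>) (2 ^ j) \<le> \<omega> (2 ^ j) * 1"
          using W(1)[of "2^j"] Gam by (intro mult_left_mono) (auto simp: dr_ind)
        also have "\<dots> \<le> 2 powr (- \<epsilon> * real (J - j)) * (A * \<omega> (2 ^ J))"
          using A(3)[OF that] by (simp add: mult_ac)
        finally show ?thesis .
      qed
    qed
    then have "lq_bracket q (\<lambda>k. \<omega> k * dr (ind \<Gamma>) k) \<le> ennreal (D * (G * (A * \<omega> (2 ^ J))))"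
      using slowly_growing_mult[OF D(2) dr_slowly_growing, of "ind \<Gamma>"] D(1) G(1) A(1) wJ
      by (intro lq_bracket_le_if_dyadic[OF q]) auto
    then show "lorentz_norm sc qn e q \<omega> (ind \<Gamma>) \<le> ennreal (D * (G * A) * \<omega> (2 ^ J))"
      by (simp add: lorentz_norm_def mult.assoc)
  qed
qed

text \<open>All consequences of a lower embedding come from this estimate. The sets have up to \<open>2\<^sup>J\<^sup>+\<^sup>1\<close> points, twice the number of terms of the
approximants, so that approximation cannot exhaust them.\<close>

lemma err_ind_le_weight:
  assumes q: "0 < q" and \<alpha>: "0 < \<alpha>" and w: "\<omega> \<in> weights_plus"
    and emb: "embeds (lorentz_norm sc qn e q \<omega>) (approx_norm sc qn e \<alpha> q)"
  obtains C where "0 < C"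
    "\<And>J \<Gamma>. finite \<Gamma> \<Longrightarrow> card \<Gamma> \<le> 2 ^ (J + 1) \<Longrightarrow> real (2 ^ J) powr \<alpha> * err (2 ^ J) (ind \<Gamma>) \<le> C * \<omega> (2 ^ J)"
proof -
  have w': "\<omega> \<in> weights" using w by (auto simp: weights_plus_def)
  note W = weightsD[OF w']
  obtain D where D: "1 \<le> D" "slowly_growing D \<omega>"
    using slowly_growing_if_doubling[OF W(2,3)] W(1) by (metis less_imp_le)
  obtain L where L: "0 < L"
    "\<And>J \<Gamma>. finite \<Gamma> \<Longrightarrow> card \<Gamma> \<le> 2 ^ J \<Longrightarrow> lorentz_norm sc qn e q \<omega> (ind \<Gamma>) \<le> ennreal (L * \<omega> (2 ^ J))"
    using lorentz_ind_le[OF q w] by metis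
  obtain E where E: "0 < E" "\<And>x R. 0 \<le> R \<Longrightarrow> lorentz_norm sc qn e q \<omega> x \<le> ennreal R \<Longrightarrow>
      approx_norm sc qn e \<alpha> q x \<le> ennreal (E * R)"
    using embedsE[OF emb] by metis
  have a1: "1 \<le> 2 powr \<alpha>" using \<alpha> by (simp add: ge_one_powr_ge_zero)
  obtain C1 where C1: "0 < C1"
    "\<And>a R. slowly_growing (2 powr \<alpha>) a \<Longrightarrow> 0 \<le> R \<Longrightarrow> lq_bracket q a \<le> ennreal R \<Longrightarrow> lq_le q (\<lambda>j. a (2 ^ j)) (C1 * R)"
    using dyadic_le_if_lq_bracket[OF q a1] by metis
  show thesis
  proof (rule that)
    show "0 < C1 * (E * (L * D))" using C1 E L D by simp
    fix J :: nat and \<Gamma> :: "nat set" assume G: "finite \<Gamma>" "card \<Gamma> \<le> 2 ^ (J + 1)"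
    have wJ: "0 < \<omega> (2 ^ (J + 1))" by (rule W(1)) simp
    define R where "R = L * \<omega> (2 ^ (J + 1))"
    have R: "0 \<le> R" using L wJ by (simp add: R_def)
    have "approx_norm sc qn e \<alpha> q (ind \<Gamma>) \<le> ennreal (E * R)"
      using E(2)[OF R] L(2)[OF G] by (simp add: R_def)
    then have "lq_bracket q (\<lambda>N. real N powr \<alpha> * err N (ind \<Gamma>)) \<le> ennreal (E * R)"
      using E R by (intro approx_normD) auto
    then have le: "lq_le q (\<lambda>j. real (2 ^ j) powr \<alpha> * err (2 ^ j) (ind \<Gamma>)) (C1 * (E * R))"
      using E R by (intro C1(2)[OF err_slowly_growing[OF \<alpha>]]) auto
    have "real (2 ^ J) powr \<alpha> * err (2 ^ J) (ind \<Gamma>) \<le> C1 * (E * R)"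
      by (rule lq_le_pointwise[OF q _ _ le]) (use C1(1) E(1) R err_nonneg in auto)
    also have "\<dots> = C1 * (E * (L * \<omega> (2 ^ (J + 1))))" by (simp add: R_def)
    also have "\<dots> \<le> C1 * (E * (L * (D * \<omega> (2 ^ J))))"
      using D(2) C1(1) E(1) L(1) unfolding slowly_growing_def by (intro mult_left_mono) auto
    finally show "real (2 ^ J) powr \<alpha> * err (2 ^ J) (ind \<Gamma>) \<le> C1 * (E * (L * D)) * \<omega> (2 ^ J)"
      by (simp add: mult.assoc)
  qed
qed

text \<open>Deleting \<open>2\<^sup>J\<close> of \<open>2\<^sup>J\<^sup>+\<^sup>1\<close> points leaves a point, and a vector \<open>1\<^sub>\<Gamma>\<close> with \<open>\<Gamma> \<noteq> {}\<close> has norm at least 1.\<close>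

lemma powr_lesssim_weight:
  assumes q: "0 < q" and \<alpha>: "0 < \<alpha>" and w: "\<omega> \<in> weights_plus"
    and emb: "embeds (lorentz_norm sc qn e q \<omega>) (approx_norm sc qn e \<alpha> q)"
  shows "lesssim (\<lambda>k. real k powr \<alpha>) \<omega>"
proof -
  obtain C where C: "0 < C"
    "\<And>J \<Gamma>. finite \<Gamma> \<Longrightarrow> card \<Gamma> \<le> 2 ^ (J + 1) \<Longrightarrow> real (2 ^ J) powr \<alpha> * err (2 ^ J) (ind \<Gamma>) \<le> C * \<omega> (2 ^ J)"
    using err_ind_le_weight[OF assms] by metis
  have inc: "incr_weight \<omega>" using w weightsD by (auto simp: weights_plus_def)
  show ?thesis
  proof (rule lesssim_if_dyadic[OF slowly_growing_powr _ inc C(1)])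
    fix J :: nat
    define \<Gamma> :: "nat set" where "\<Gamma> = {..<2 ^ (J + 1)}"
    have "1 \<le> err (2 ^ J) (ind \<Gamma>)"
    proof (rule le_err_ind)
      fix \<Gamma>' assume G: "\<Gamma>' \<subseteq> \<Gamma>" "card (\<Gamma> - \<Gamma>') \<le> 2 ^ J"
      then have "\<Gamma>' \<noteq> {}" by (auto simp: \<Gamma>_def)
      then show "1 \<le> qn (ind \<Gamma>')" using G by (intro qn_ind_ge_1) (auto simp: \<Gamma>_def finite_subset)
    qed (simp add: \<Gamma>_def)
    then have "real (2 ^ J) powr \<alpha> * 1 \<le> real (2 ^ J) powr \<alpha> * err (2 ^ J) (ind \<Gamma>)"
      by (intro mult_left_mono) auto
    also have "\<dots> \<le> C * \<omega> (2 ^ J)" by (rule C(2)) (auto simp: \<Gamma>_def)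
    finally show "real (2 ^ J) powr \<alpha> \<le> C * \<omega> (2 ^ J)" by simp
  qed (use \<alpha> in auto)
qed

text \<open>By \<open>le_err_ind\<close> some set of at most \<open>2\<^sup>J\<close> points can be removed from a set of \<open>2\<^sup>J\<^sup>+\<^sup>1\<close> points such that the rest has norm at most
\<open>K \<eta>(2\<^sup>J\<^sup>+\<^sup>1)\<close>; the removed set is treated by induction, and the \<open>\<rho>\<close>-triangle inequality adds up the steps.\<close>

lemma hr_powr_le_sum:
  assumes e0: "\<And>k. 1 \<le> k \<Longrightarrow> 0 < \<eta> k" and inc: "incr_weight \<eta>" and C: "0 < C"
    and err: "\<And>J \<Gamma>. finite \<Gamma> \<Longrightarrow> card \<Gamma> \<le> 2 ^ (J + 1) \<Longrightarrow> err (2 ^ J) (ind \<Gamma>) \<le> C * \<eta> (2 ^ J)"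
  obtains K where "0 < K" "\<And>J. hr (2 ^ J) powr \<rho> \<le> (\<Sum>j\<le>J. (K * \<eta> (2 ^ j)) powr \<rho>)"
proof -
  \<comment> \<open>The factor 2 makes the bound on the error strict, so that a set \<open>\<Gamma>'\<close> below it exists; the
    second entry starts the induction at singletons.\<close>
  define K where "K = max (2 * C) (1 / \<eta> 1)"
  have K: "0 < K" "2 * C \<le> K" "1 \<le> K * \<eta> 1"
  proof -
    show "0 < K" "2 * C \<le> K" using C by (auto simp: K_def less_max_iff_disj)
    have "1 / \<eta> 1 * \<eta> 1 \<le> K * \<eta> 1" using e0[of 1] by (intro mult_right_mono) (auto simp: K_def)
    then show "1 \<le> K * \<eta> 1" using e0[of 1] by simp
  qed
  have ind: "qn (ind \<Gamma>) powr \<rho> \<le> (\<Sum>j\<le>J. (K * \<eta> (2 ^ j)) powr \<rho>)"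
    if "finite \<Gamma>" "card \<Gamma> \<le> 2 ^ J" for J \<Gamma>
    using that
  proof (induction J arbitrary: \<Gamma>)
    case 0
    have "qn (ind \<Gamma>) powr \<rho> \<le> 1" using qn_ind_powr_le_card[OF 0(1)] 0(2) by simp
    also have "1 \<le> (K * \<eta> 1) powr \<rho>" using K rho_pos by (simp add: ge_one_powr_ge_zero)
    finally show ?case by simp
  next
    case (Suc J)
    have eJ: "0 < \<eta> (2 ^ J)" by (rule e0) simp
    have "err (2 ^ J) (ind \<Gamma>) \<le> C * \<eta> (2 ^ J)" using Suc.prems by (intro err) auto
    also have "\<dots> < 2 * C * \<eta> (2 ^ J)" using C eJ by simp
    also have "\<dots> \<le> K * \<eta> (2 ^ J)" using K eJ by (intro mult_right_mono) auto
    also have "\<dots> \<le> K * \<eta> (2 ^ Suc J)"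
      using K by (intro mult_left_mono incr_weight_mono[OF inc]) auto
    finally have "\<not> K * \<eta> (2 ^ Suc J) \<le> err (2 ^ J) (ind \<Gamma>)" by simp
    then obtain \<Gamma>' where G: "\<Gamma>' \<subseteq> \<Gamma>" "card (\<Gamma> - \<Gamma>') \<le> 2 ^ J" "qn (ind \<Gamma>') < K * \<eta> (2 ^ Suc J)"
      using le_err_ind[OF Suc.prems(1), of "2 ^ J" "K * \<eta> (2 ^ Suc J)"] by (meson not_le)
    have "qn (ind \<Gamma>) powr \<rho> \<le> qn (ind \<Gamma>') powr \<rho> + qn (ind (\<Gamma> - \<Gamma>')) powr \<rho>"
      by (rule qn_ind_Un[OF Suc.prems(1) G(1)])
    also have "\<dots> \<le> (K * \<eta> (2 ^ Suc J)) powr \<rho> + (\<Sum>j\<le>J. (K * \<eta> (2 ^ j)) powr \<rho>)"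
      using G Suc.prems rho_pos qn_nonneg by (intro add_mono powr_mono2 Suc.IH) auto
    finally show ?case by simp
  qed
  show thesis
  proof (rule that[OF K(1)])
    fix J
    let ?S = "\<Sum>j\<le>J. (K * \<eta> (2 ^ j)) powr \<rho>"
    have S: "0 \<le> ?S" by (rule sum_nonneg) simp
    have "hr (2 ^ J) \<le> ?S powr (1/\<rho>)"
    proof (rule hr_le)
      fix \<Gamma> :: "nat set" assume "finite \<Gamma>" "card \<Gamma> = 2 ^ J"
      then show "qn (ind \<Gamma>) \<le> ?S powr (1/\<rho>)"
        using ind[of \<Gamma> J] rho_pos S by (intro qn_powr_le_cancel) (auto simp: powr_powr)
    qed
    then have "hr (2 ^ J) powr \<rho> \<le> (?S powr (1/\<rho>)) powr \<rho>"
      using rho_pos hr_nonneg by (intro powr_mono2) auto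
    then show "hr (2 ^ J) powr \<rho> \<le> ?S" using rho_pos S by (simp add: powr_powr)
  qed
qed

text \<open>If \<open>\<eta>(2\<^sup>j)\<close> grows geometrically, the sum of the \<open>\<rho>\<close>-th powers is comparable to its last term; this is the estimate for
geometric tails with exponent \<open>q = \<rho>\<close>.\<close>

lemma hr_lesssim_if_dil_less_1:
  assumes e0: "\<And>k. 1 \<le> k \<Longrightarrow> 0 < \<eta> k" and inc: "incr_weight \<eta>" and C: "0 < C"
    and err: "\<And>J \<Gamma>. finite \<Gamma> \<Longrightarrow> card \<Gamma> \<le> 2 ^ (J + 1) \<Longrightarrow> err (2 ^ J) (ind \<Gamma>) \<le> C * \<eta> (2 ^ J)"
    and \<kappa>: "1 < \<kappa>" "dil \<eta> \<kappa> < 1"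
  shows "lesssim hr \<eta>"
proof -
  obtain K where K: "0 < K" "\<And>J. hr (2 ^ J) powr \<rho> \<le> (\<Sum>j\<le>J. (K * \<eta> (2 ^ j)) powr \<rho>)"
    using hr_powr_le_sum[OF assms(1-4)] by metis
  obtain A \<epsilon> where A: "0 < A" "0 < \<epsilon>"
    "\<And>j J. j \<le> J \<Longrightarrow> \<eta> (2 ^ j) \<le> A * 2 powr (- \<epsilon> * real (J - j)) * \<eta> (2 ^ J)"
    using dyadic_growth_if_dil_less_1[OF e0 inc \<kappa>] by metis
  have \<rho>q: "0 < ennreal \<rho>" using rho_pos by simp
  obtain G where G: "0 < G"
    "\<And>v J R. 0 \<le> R \<Longrightarrow> (\<And>j. 0 \<le> v j) \<Longrightarrow> (\<And>j. j \<le> J \<Longrightarrow> v j \<le> 2 powr (- \<epsilon> * real (J - j)) * R) \<Longrightarrow>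
       (\<And>j. J < j \<Longrightarrow> v j = 0) \<Longrightarrow> lq_le (ennreal \<rho>) v (G * R)"
    using lq_le_geometric_tail[OF \<rho>q A(2)] by metis
  show ?thesis
  proof (rule lesssim_if_dyadic[OF hr_slowly_growing _ inc])
    show "0 < G * (K * A)" using G K A by simp
    fix J
    have eJ: "0 < \<eta> (2 ^ J)" by (rule e0) simp
    define v where "v j = (if j \<le> J then K * \<eta> (2 ^ j) else 0)" for j
    define R where "R = K * (A * \<eta> (2 ^ J))"
    have R: "0 \<le> R" using K(1) A(1) eJ by (simp add: R_def)
    have "lq_le (ennreal \<rho>) v (G * R)"
    proof (rule G(2)[OF R])
      show "0 \<le> v j" for j using K(1) e0[of "2^j"] by (simp add: v_def)
      show "v j \<le> 2 powr (- \<epsilon> * real (J - j)) * R" if "j \<le> J" for j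
      proof -
        have "K * \<eta> (2 ^ j) \<le> K * (A * 2 powr (- \<epsilon> * real (J - j)) * \<eta> (2 ^ J))"
          using A(3)[OF that] K(1) by (intro mult_left_mono) auto
        then show ?thesis using that by (simp add: v_def R_def mult_ac)
      qed
    qed (simp add: v_def)
    then have "(\<Sum>j<Suc J. v j powr \<rho>) \<le> (G * R) powr \<rho>"
      using rho_pos unfolding lq_le_def by (simp add: less_imp_le del: sum.lessThan_Suc)
    also have "(\<Sum>j<Suc J. v j powr \<rho>) = (\<Sum>j\<le>J. (K * \<eta> (2 ^ j)) powr \<rho>)"
      unfolding lessThan_Suc_atMost by (rule sum.cong) (auto simp: v_def)
    finally have "hr (2 ^ J) powr \<rho> \<le> (G * R) powr \<rho>" using K(2)[of J] by linarith
    then have "hr (2 ^ J) \<le> G * R"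
      using rho_pos hr_nonneg G(1) R by (meson mult_nonneg_nonneg less_imp_le powr_less_mono2 not_le)
    then show "hr (2 ^ J) \<le> G * (K * A) * \<eta> (2 ^ J)" by (simp add: R_def mult_ac)
  qed simp
qed

text \<open>Each of the \<open>J + 1\<close> terms of the sum is at most the last one, and \<open>J + 1\<close> is comparable to \<open>ln (2\<^sup>J + 1)\<close>.\<close>

lemma hr_div_log_lesssim:
  assumes e0: "\<And>k. 1 \<le> k \<Longrightarrow> 0 < \<eta> k" and inc: "incr_weight \<eta>" and C: "0 < C"
    and err: "\<And>J \<Gamma>. finite \<Gamma> \<Longrightarrow> card \<Gamma> \<le> 2 ^ (J + 1) \<Longrightarrow> err (2 ^ J) (ind \<Gamma>) \<le> C * \<eta> (2 ^ J)"
  shows "lesssim (\<lambda>k. hr k / ln (real (k + 1)) powr (1 / \<rho>)) \<eta>"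
proof -
  obtain K where K: "0 < K" "\<And>J. hr (2 ^ J) powr \<rho> \<le> (\<Sum>j\<le>J. (K * \<eta> (2 ^ j)) powr \<rho>)"
    using hr_powr_le_sum[OF assms(1-4)] by metis
  define l where "l k = 1 / ln (real (k + 1)) powr (1 / \<rho>)" for k :: nat
  have l_slowly_growing: "slowly_growing 1 l"
  proof (rule slowly_growing_if_decreasing)
    fix j k :: nat assume jk: "1 \<le> j" "j \<le> k"
    have "0 < ln (real (j + 1))" using jk by simp
    moreover have "ln (real (j + 1)) \<le> ln (real (k + 1))" using jk by simp
    ultimately show "l k \<le> l j" unfolding l_def using rho_pos
      by (intro divide_left_mono powr_mono2 mult_pos_pos) auto
  qed (simp add: l_def)
  have sl: "slowly_growing (2 powr (1/\<rho>) * 1) (\<lambda>k. hr k * l k)"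
    by (rule slowly_growing_mult[OF hr_slowly_growing l_slowly_growing]) auto
  have "lesssim (\<lambda>k. hr k * l k) \<eta>"
  proof (rule lesssim_if_dyadic[OF sl _ inc])
    let ?c = "(2 / ln 2) powr (1/\<rho>)"
    show "0 < ?c * K" using K by simp
    fix J :: nat
    have eJ: "0 < \<eta> (2 ^ J)" by (rule e0) simp
    define L where "L = ln (real (2 ^ J + 1))"
    have L: "real (J + 1) * ln 2 / 2 \<le> L"
    proof -
      have "ln (2 ^ J) \<le> L" unfolding L_def by (intro ln_mono) auto
      then have 1: "real J * ln 2 \<le> L" by (simp add: ln_realpow)
      have 2: "ln 2 \<le> L" unfolding L_def by (intro ln_mono) auto
      from 1 2 show ?thesis by (simp add: algebra_simps)
    qed
    have ln2: "0 < ln (2::real)" by simp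
    have L0: "0 < L" using L ln2 by (smt (verit) divide_pos_pos mult_pos_pos of_nat_0_less_iff zero_less_Suc Suc_eq_plus1)
    have "hr (2 ^ J) powr \<rho> \<le> (\<Sum>j\<le>J. (K * \<eta> (2 ^ j)) powr \<rho>)" by (rule K)
    also have "\<dots> \<le> (\<Sum>j\<le>J. (K * \<eta> (2 ^ J)) powr \<rho>)"
      using K(1) rho_pos e0 by (intro sum_mono powr_mono2 mult_left_mono incr_weight_mono[OF inc])
        (auto simp: less_imp_le)
    also have "\<dots> = real (J + 1) * (K * \<eta> (2 ^ J)) powr \<rho>" by simp
    also have "\<dots> \<le> (2 / ln 2 * L) * (K * \<eta> (2 ^ J)) powr \<rho>"
      using L ln2 by (intro mult_right_mono) (auto simp: field_simps)
    also have "\<dots> = (?c * L powr (1/\<rho>) * (K * \<eta> (2 ^ J))) powr \<rho>"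
      using rho_pos L0 K(1) eJ ln2 by (simp add: powr_mult powr_powr)
    finally have "hr (2 ^ J) \<le> ?c * L powr (1/\<rho>) * (K * \<eta> (2 ^ J))"
      using rho_pos hr_nonneg K(1) eJ
      by (meson mult_nonneg_nonneg less_imp_le powr_less_mono2 not_le powr_ge_zero)
    then have "hr (2 ^ J) * (1 / L powr (1/\<rho>)) \<le> ?c * K * \<eta> (2 ^ J)"
      using L0 by (simp add: field_simps)
    then show "hr (2 ^ J) * l (2 ^ J) \<le> ?c * K * \<eta> (2 ^ J)"
      by (simp add: l_def L_def)
  qed simp
  then show ?thesis by (simp add: l_def)
qed

text \<open>Deleting half of a set of Property (H) leaves at least half of it, whose norm is then comparable to \<open>h\<^sub>r(2\<^sup>J)\<close>.\<close>

lemma powr_hr_lesssim_if_property_H: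
  assumes q: "0 < q" and \<alpha>: "0 < \<alpha>" and w: "\<omega> \<in> weights_plus"
    and emb: "embeds (lorentz_norm sc qn e q \<omega>) (approx_norm sc qn e \<alpha> q)"
    and H: "property_H qn e"
  shows "lesssim (\<lambda>k. real k powr \<alpha> * hr k) \<omega>"
proof -
  obtain C where C: "0 < C"
    "\<And>J \<Gamma>. finite \<Gamma> \<Longrightarrow> card \<Gamma> \<le> 2 ^ (J + 1) \<Longrightarrow> real (2 ^ J) powr \<alpha> * err (2 ^ J) (ind \<Gamma>) \<le> C * \<omega> (2 ^ J)"
    using err_ind_le_weight[OF q \<alpha> w emb] by metis
  obtain c c' where c: "0 < c" and H': "\<forall>n\<ge>1. \<exists>\<Gamma>. finite \<Gamma> \<and> card \<Gamma> = 2 ^ n \<and>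
     (\<forall>\<Gamma>'\<subseteq>\<Gamma>. card \<Gamma>' = 2 ^ (n - 1) \<longrightarrow>
        c * hr (2 ^ (n - 1)) \<le> qn (ind \<Gamma>') \<and> qn (ind \<Gamma>') \<le> c' * hr (2 ^ (n - 1)))"
    using H unfolding property_H_def ind_def[symmetric] by (elim exE conjE) (rule that)
  have inc: "incr_weight \<omega>" using w weightsD by (auto simp: weights_plus_def)
  have sl: "slowly_growing (2 powr \<alpha> * 2 powr (1/\<rho>)) (\<lambda>k. real k powr \<alpha> * hr k)"
    using \<alpha> by (intro slowly_growing_mult slowly_growing_powr hr_slowly_growing) auto
  show ?thesis
  proof (rule lesssim_if_dyadic[OF sl _ inc])
    show "0 < C / c" using C c by simp
    fix J :: nat
    obtain \<Gamma> where G: "finite \<Gamma>" "card \<Gamma> = 2 ^ (J + 1)"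
      and GH: "\<And>\<Gamma>'. \<Gamma>' \<subseteq> \<Gamma> \<Longrightarrow> card \<Gamma>' = 2 ^ J \<Longrightarrow> c * hr (2 ^ J) \<le> qn (ind \<Gamma>')"
      using H'[rule_format, of "J + 1"] by auto
    have "c * hr (2 ^ J) \<le> err (2 ^ J) (ind \<Gamma>)"
    proof (rule le_err_ind[OF G(1)])
      fix \<Gamma>' assume G': "\<Gamma>' \<subseteq> \<Gamma>" "card (\<Gamma> - \<Gamma>') \<le> 2 ^ J"
      have fin: "finite \<Gamma>'" using G G' finite_subset by blast
      have "2 ^ J \<le> card \<Gamma>'" using G G' fin by (simp add: card_Diff_subset)
      then obtain \<Delta> where "\<Delta> \<subseteq> \<Gamma>'" "card \<Delta> = 2 ^ J" by (metis obtain_subset_with_card_n)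
      then show "c * hr (2 ^ J) \<le> qn (ind \<Gamma>')"
        using GH[of \<Delta>] G'(1) qn_ind_mono[OF fin, of \<Delta>] by (meson order_trans)
    qed
    then have "real (2 ^ J) powr \<alpha> * (c * hr (2 ^ J)) \<le> real (2 ^ J) powr \<alpha> * err (2 ^ J) (ind \<Gamma>)"
      by (intro mult_left_mono) auto
    also have "\<dots> \<le> C * \<omega> (2 ^ J)" using G by (intro C) auto
    finally show "real (2 ^ J) powr \<alpha> * hr (2 ^ J) \<le> C / c * \<omega> (2 ^ J)"
      using c(1) by (simp add: field_simps)
  qed simp
qed

section \<open>Optimality of the upper embedding\<close>

text \<open>The errors of \<open>1\<^sub>\<Gamma>\<close> are at most its norm and vanish from \<open>2\<^sup>J\<close> terms on, and the factors \<open>N\<^sup>\<alpha>\<close> grow geometrically along the powers of two.\<close>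

lemma approx_norm_ind_le:
  assumes q: "0 < q" and \<alpha>: "0 < \<alpha>"
  obtains C where "0 < C"
    "\<And>J \<Gamma>. finite \<Gamma> \<Longrightarrow> card \<Gamma> \<le> 2 ^ J \<Longrightarrow>
       approx_norm sc qn e \<alpha> q (ind \<Gamma>) \<le> ennreal (C * (real (2 ^ J) powr \<alpha> * qn (ind \<Gamma>)))"
proof -
  obtain G where G: "0 < G"
    "\<And>v J R. 0 \<le> R \<Longrightarrow> (\<And>j. 0 \<le> v j) \<Longrightarrow> (\<And>j. j \<le> J \<Longrightarrow> v j \<le> 2 powr (- \<alpha> * real (J - j)) * R) \<Longrightarrow>
       (\<And>j. J < j \<Longrightarrow> v j = 0) \<Longrightarrow> lq_le q v (G * R)"
    using lq_le_geometric_tail[OF q \<alpha>] by metis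
  show thesis
  proof (rule that)
    show "0 < 1 + 2 powr \<alpha> * G" using G by (intro add_pos_pos) auto
    fix J :: nat and \<Gamma> :: "nat set" assume Gam: "finite \<Gamma>" "card \<Gamma> \<le> 2 ^ J"
    define R where "R = real (2 ^ J) powr \<alpha> * qn (ind \<Gamma>)"
    have R: "0 \<le> R" using qn_nonneg by (simp add: R_def)
    have "1 \<le> real (2 ^ J) powr \<alpha>" using \<alpha> by (intro ge_one_powr_ge_zero) auto
    then have qR: "qn (ind \<Gamma>) \<le> R"
      using mult_right_mono[of 1 "real (2 ^ J) powr \<alpha>" "qn (ind \<Gamma>)"] qn_nonneg by (simp add: R_def)
    have "lq_le q (\<lambda>j. real (2 ^ j) powr \<alpha> * err (2 ^ j) (ind \<Gamma>)) (G * R)"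
    proof (rule G(2)[OF R])
      show "0 \<le> real (2 ^ j) powr \<alpha> * err (2 ^ j) (ind \<Gamma>)" for j using err_nonneg by simp
      show "real (2 ^ j) powr \<alpha> * err (2 ^ j) (ind \<Gamma>) = 0" if "J < j" for j
      proof -
        have "(2::nat) ^ J \<le> 2 ^ j" using that by simp
        then have "card \<Gamma> \<le> 2 ^ j" using Gam by linarith
        then show ?thesis using Gam err_ind_eq_0 by simp
      qed
      show "real (2 ^ j) powr \<alpha> * err (2 ^ j) (ind \<Gamma>) \<le> 2 powr (- \<alpha> * real (J - j)) * R" if "j \<le> J" for j
      proof -
        have "real (2 ^ j) powr \<alpha> = 2 powr (- \<alpha> * real (J - j)) * real (2 ^ J) powr \<alpha>"
          unfolding real_2_power_powr using that by (simp add: powr_add[symmetric] of_nat_diff algebra_simps)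
        then show ?thesis using err_le_qn[of "2^j" "ind \<Gamma>"] by (simp add: R_def mult_left_mono)
      qed
    qed
    then have "lq_bracket q (\<lambda>N. real N powr \<alpha> * err N (ind \<Gamma>)) \<le> ennreal (2 powr \<alpha> * (G * R))"
      using G(1) R by (intro lq_bracket_le_if_dyadic[OF q _ _ err_slowly_growing[OF \<alpha>]]) auto
    then have "approx_norm sc qn e \<alpha> q (ind \<Gamma>) \<le> ennreal (R + 2 powr \<alpha> * (G * R))"
      using R qR G(1) by (intro approx_normI) auto
    then show "approx_norm sc qn e \<alpha> q (ind \<Gamma>) \<le> ennreal ((1 + 2 powr \<alpha> * G) * (real (2 ^ J) powr \<alpha> * qn (ind \<Gamma>)))"
      unfolding R_def[symmetric] by (simp add: algebra_simps)
  qed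
qed

text \<open>The Lorentz norm of \<open>1\<^sub>\<Gamma>\<close> with \<open>|\<Gamma>| = 2\<^sup>J\<close> dominates the single sample \<open>\<omega>(2\<^sup>J)\<close>. The set \<open>\<Gamma>\<close> is chosen nearly
minimal for \<open>h\<^sub>\<ell>(2\<^sup>J)\<close>, up to a factor 2, since the infimum may fail to be attained.\<close>

lemma weight_lesssim_powr_hl:
  assumes q: "0 < q" and \<alpha>: "0 < \<alpha>" and w: "\<omega> \<in> weights"
    and emb: "embeds (approx_norm sc qn e \<alpha> q) (lorentz_norm sc qn e q \<omega>)"
  shows "lesssim \<omega> (\<lambda>k. real k powr \<alpha> * hl k)"
proof -
  note W = weightsD[OF w]
  obtain D where D: "1 \<le> D" "slowly_growing D \<omega>"
    using slowly_growing_if_doubling[OF W(2,3)] W(1) by (metis less_imp_le)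
  obtain B where B: "0 < B" "\<And>J \<Gamma>. finite \<Gamma> \<Longrightarrow> card \<Gamma> \<le> 2 ^ J \<Longrightarrow>
       approx_norm sc qn e \<alpha> q (ind \<Gamma>) \<le> ennreal (B * (real (2 ^ J) powr \<alpha> * qn (ind \<Gamma>)))"
    using approx_norm_ind_le[OF q \<alpha>] by metis
  obtain E where E: "0 < E" "\<And>x R. 0 \<le> R \<Longrightarrow> approx_norm sc qn e \<alpha> q x \<le> ennreal R \<Longrightarrow>
      lorentz_norm sc qn e q \<omega> x \<le> ennreal (E * R)"
    using embedsE[OF emb] by metis
  obtain C1 where C1: "0 < C1"
    "\<And>a R. slowly_growing D a \<Longrightarrow> 0 \<le> R \<Longrightarrow> lq_bracket q a \<le> ennreal R \<Longrightarrow> lq_le q (\<lambda>j. a (2 ^ j)) (C1 * R)"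
    using dyadic_le_if_lq_bracket[OF q D(1)] by metis
  have inc: "incr_weight (\<lambda>k. real k powr \<alpha> * hl k)"
    unfolding incr_weight_def
  proof (intro allI impI mult_mono)
    fix k :: nat assume k: "1 \<le> k"
    show "hl k \<le> hl (k + 1)" using hl_incr k by (simp add: incr_weight_def)
    show "real k powr \<alpha> \<le> real (k + 1) powr \<alpha>" using \<alpha> by (intro powr_mono2) auto
    show "0 \<le> hl k" using hl_ge_1[OF k] by linarith
  qed auto
  show ?thesis
  proof (rule lesssim_if_dyadic[OF D(2) _ inc])
    show "0 < 2 * (C1 * (E * B))" using C1 E B by simp
    fix J :: nat
    have h1: "1 \<le> hl (2 ^ J)" by (rule hl_ge_1) simp
    have "\<exists>\<Gamma>. finite \<Gamma> \<and> card \<Gamma> = 2 ^ J \<and> qn (ind \<Gamma>) \<le> 2 * hl (2 ^ J)"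
    proof (rule ccontr)
      assume "\<not> ?thesis"
      then have "2 * hl (2 ^ J) \<le> hl (2 ^ J)" by (intro le_hl) (auto simp: not_le less_imp_le)
      then show False using h1 by simp
    qed
    then obtain \<Gamma> where G: "finite \<Gamma>" "card \<Gamma> = 2 ^ J" "qn (ind \<Gamma>) \<le> 2 * hl (2 ^ J)" by blast
    define R where "R = B * (real (2 ^ J) powr \<alpha> * qn (ind \<Gamma>))"
    have R: "0 \<le> R" using B qn_nonneg by (simp add: R_def)
    have "lorentz_norm sc qn e q \<omega> (ind \<Gamma>) \<le> ennreal (E * R)"
      using E(2)[OF R] B(2)[OF G(1)] G(2) by (simp add: R_def)
    moreover have "slowly_growing D (\<lambda>k. \<omega> k * dr (ind \<Gamma>) k)"
      using slowly_growing_mult[OF D(2) dr_slowly_growing, of "ind \<Gamma>"] D(1) by simp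
    ultimately have le: "lq_le q (\<lambda>j. \<omega> (2 ^ j) * dr (ind \<Gamma>) (2 ^ j)) (C1 * (E * R))"
      using E(1) R unfolding lorentz_norm_def by (intro C1(2)) auto
    have "\<omega> (2 ^ J) = \<omega> (2 ^ J) * dr (ind \<Gamma>) (2 ^ J)" using G by (simp add: dr_ind)
    also have "\<dots> \<le> C1 * (E * R)"
    proof (rule lq_le_pointwise[OF q _ _ le])
      show "0 \<le> C1 * (E * R)" using C1(1) E(1) R by simp
      show "0 \<le> \<omega> (2 ^ j) * dr (ind \<Gamma>) (2 ^ j)" for j
        using W(1)[of "2^j"] dr_nonneg[of "2^j" "ind \<Gamma>"] by simp
    qed
    also have "\<dots> \<le> C1 * (E * (B * (real (2 ^ J) powr \<alpha> * (2 * hl (2 ^ J)))))"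
      unfolding R_def using C1(1) E(1) B(1) G(3) by (intro mult_left_mono) auto
    finally show "\<omega> (2 ^ J) \<le> 2 * (C1 * (E * B)) * (real (2 ^ J) powr \<alpha> * hl (2 ^ J))"
      by (simp add: mult_ac)
  qed (use D in simp)
qed

end

section \<open>The embedding theorem and its optimality\<close>

theorem theorem1p4:
  fixes sc :: "'k::real_normed_field \<Rightarrow> 'a::ab_group_add \<Rightarrow> 'a"
    and qn :: "'a \<Rightarrow> real" and \<rho> :: real and e :: "nat \<Rightarrow> 'a"
    and \<alpha> :: real and q :: ennreal
  assumes "quasi_banach sc qn \<rho>"
    and "unconditional_basis sc qn e 1"
    and "\<And>j. qn (e j) = 1"
    and "doubling (h_left qn e)"
    and "0 < \<alpha>" and "0 < q"
  shows "embeds (lorentz_norm sc qn e q (\<lambda>k. real k powr \<alpha> * h_right qn e k))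
                (approx_norm sc qn e \<alpha> q)
    \<and> embeds (approx_norm sc qn e \<alpha> q)
             (lorentz_norm sc qn e q (\<lambda>k. real k powr \<alpha> * h_left qn e k))
    \<and> (\<forall>\<omega>\<in>weights_plus. embeds (lorentz_norm sc qn e q \<omega>) (approx_norm sc qn e \<alpha> q) \<longrightarrow>
          lesssim (\<lambda>k. real k powr \<alpha>) \<omega>
        \<and> (\<forall>\<eta>. (\<forall>k\<ge>1. \<omega> k = real k powr \<alpha> * \<eta> k) \<and> incr_weight \<eta> \<and> doubling \<eta> \<longrightarrow>
              (0 < lower_index \<eta> \<longrightarrow> lesssim (h_right qn e) \<eta>)
            \<and> (lower_index \<eta> = 0 \<longrightarrow>
                 lesssim (\<lambda>k. h_right qn e k / ln (real (k + 1)) powr (1 / \<rho>)) \<eta>))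
        \<and> (property_H qn e \<longrightarrow> lesssim (\<lambda>k. real k powr \<alpha> * h_right qn e k) \<omega>))
    \<and> (\<forall>\<omega>\<in>weights. embeds (approx_norm sc qn e \<alpha> q) (lorentz_norm sc qn e q \<omega>) \<longrightarrow>
          lesssim \<omega> (\<lambda>k. real k powr \<alpha> * h_left qn e k))"
proof -
  interpret quasi_banach sc qn \<rho> by (rule assms(1))
  interpret normalized_unconditional_basis sc qn \<rho> e
    using assms(2,3) by unfold_locales auto
  show ?thesis
  proof (intro conjI ballI allI impI)
    fix \<omega> assume w: "\<omega> \<in> weights_plus"
      and emb: "embeds (lorentz_norm sc qn e q \<omega>) (approx_norm sc qn e \<alpha> q)"
    fix \<eta> assume eta: "(\<forall>k\<ge>1. \<omega> k = real k powr \<alpha> * \<eta> k) \<and> incr_weight \<eta> \<and> doubling \<eta>"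
    have e0: "0 < \<eta> k" if "1 \<le> k" for k
    proof -
      have "0 < \<omega> k" using w that weightsD(1) by (auto simp: weights_plus_def)
      then show ?thesis using eta that by (simp add: zero_less_mult_iff)
    qed
    obtain C where C: "0 < C" "\<And>J \<Gamma>. finite \<Gamma> \<Longrightarrow> card \<Gamma> \<le> 2 ^ (J + 1) \<Longrightarrow>
        real (2 ^ J) powr \<alpha> * err (2 ^ J) (ind \<Gamma>) \<le> C * \<omega> (2 ^ J)"
      using err_ind_le_weight[OF assms(6,5) w emb] by metis
    have err: "err (2 ^ J) (ind \<Gamma>) \<le> C * \<eta> (2 ^ J)"
      if G: "finite \<Gamma>" "card \<Gamma> \<le> 2 ^ (J + 1)" for J \<Gamma>
    proof -
      have "real (2 ^ J) powr \<alpha> * err (2 ^ J) (ind \<Gamma>) \<le> C * \<omega> (2 ^ J)" by (rule C(2)[OF G])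
      also have "\<dots> = real (2 ^ J) powr \<alpha> * (C * \<eta> (2 ^ J))" using eta by simp
      finally show ?thesis by (simp add: mult_le_cancel_left_pos)
    qed
    have inc: "incr_weight \<eta>" using eta by blast
    show "lesssim hr \<eta>" if idx: "0 < lower_index \<eta>"
    proof -
      obtain m where m: "1 < m" "dil \<eta> m < 1"
        using dil_less_1_if_lower_index_pos[OF e0 inc idx] by blast
      show ?thesis by (rule hr_lesssim_if_dil_less_1[OF e0 inc C(1) err m])
    qed
    show "lesssim (\<lambda>k. hr k / ln (real (k + 1)) powr (1 / \<rho>)) \<eta>"
      by (rule hr_div_log_lesssim[OF e0 inc C(1) err])
  next
    fix \<omega> assume "\<omega> \<in> weights_plus"
      and "embeds (lorentz_norm sc qn e q \<omega>) (approx_norm sc qn e \<alpha> q)"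
    note * = assms(6,5) this
    show "lesssim (\<lambda>k. real k powr \<alpha>) \<omega>" by (rule powr_lesssim_weight[OF *])
    show "lesssim (\<lambda>k. real k powr \<alpha> * hr k) \<omega>" if "property_H qn e"
      using that by (rule powr_hr_lesssim_if_property_H[OF *])
  next
    fix \<omega> assume "\<omega> \<in> weights" "embeds (approx_norm sc qn e \<alpha> q) (lorentz_norm sc qn e q \<omega>)"
    then show "lesssim \<omega> (\<lambda>k. real k powr \<alpha> * hl k)" by (rule weight_lesssim_powr_hl[OF assms(6,5)])
  qed (rule lorentz_hr_embeds_approx[OF assms(5,6)] approx_embeds_lorentz_hl[OF assms(5,6,4)])+
qed

end
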